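(* Let $N\ge1$, let $\mu_1,\dots,\mu_N$ be non-zero real numbers, $\alpha>0$, $\nu_0>0$. For every $\nu\in\{\nu_0+k: k\in\mathbb{N}\}$ (with $\mathbb{N}=\{0,1,2,\dots\}$) let $\delta^{(\nu)}_1,\dots,\delta^{(\nu)}_N>0$ be given and assume there are real coefficients $c^{(\nu)},d^{(\nu)}$ with $$\delta^{(\nu+1)}_k=(d^{(\nu)}k+c^{(\nu)})\,\delta^{(\nu)}_k,\quad 1\le k\le N,\qquad \frac{\mu_{k+1}^2}{\mu_k^2}=d^{(\nu)}k(N-k)\frac{\delta^{(\nu)}_{k+1}}{\delta^{(\nu+1)}_k},\quad 1\le k\le N-1.$$ Then for every $\nu\in\{\nu_0+k:k\in\mathbb{N}\}$ the first order differential operator $S^{(\alpha,\nu)}$, $$(QS^{(\alpha,\nu)})(x)=\frac{dQ}{dx}(x)\,(\Phi^{(\alpha,\nu)}(x))^\ast+Q(x)\,(\Psi^{(\alpha,\nu)}(x))^\ast,$$ satisfies $$\Bigl\langle \frac{dP}{dx},Q\Bigr\rangle^{(\alpha,\nu+1)}=-\langle P,QS^{(\alpha,\nu)}\rangle^{(\alpha,\nu)}$$ for all matrix valued polynomials $P,Q\in M_N(\mathbb{C})[x]$. Moreover, for all $n\ge1$, $$\frac{dP_n^{(\alpha,\nu)}}{dx}(x)=n\,P_{n-1}^{(\alpha,\nu+1)}(x),\qquad (P_{n-1}^{(\alpha,\nu+1)}S^{(\alpha,\nu)})(x)=K_n^{(\alpha,\nu)}P_n^{(\alpha,\nu)}(x),$$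 where the matrices $K_n^{(\alpha,\nu)}$ are invertible and are explicitly given by $$L^{(\alpha)}_\mu(0)^{-1}K_n^{(\alpha,\nu)}L^{(\alpha)}_\mu(0)=d^{(\nu)}\bigl(J-(J+\nu+n)A_\mu-N-1\bigr)-c^{(\nu)}.$$
   Context: The Laguerre polynomials $L_n^{(a)}(x)$ are defined by $(1-t)^{-1-a}\exp\left(\frac{xt}{t-1}\right)=\sum_{n\ge0}L_n^{(a)}(x)t^n$. $L^{(\alpha)}_\mu(x)$ is the $N\times N$ unipotent lower triangular matrix polynomial with $L^{(\alpha)}_\mu(x)_{m,n}=\frac{\mu_m}{\mu_n}L^{(\alpha+n)}_{m-n}(x)$ for $m\ge n$ and $0$ for $m<n$. $A_\mu$ is the $N\times N$ matrix whose only non-zero entries are $(A_\mu)_{k,k-1}=-\mu_k/\mu_{k-1}$, $2\le k\le N$; $J=\mathrm{diag}(1,2,\dots,N)$. Scalars in matrix expressions denote multiples of the identity matrix. The weight is $W^{(\alpha,\nu)}_\mu(x)=L^{(\alpha)}_\mu(x)T^{(\nu)}(x)L^{(\alpha)}_\mu(x)^\ast$, $x>0$, where $T^{(\nu)}(x)$ is the diagonal matrix with $T^{(\nu)}(x)_{k,k}=e^{-x}x^{\nu+k}\delta^{(\nu)}_k$. Write $\langle P,Q\rangle^{(\alpha,\nu)}=\int_0^\infty P(x)W^{(\alpha,\nu)}_\mu(x)Q(x)^\ast dx\in M_N(\mathbb{C})$. $P_n^{(\alpha,\nu)}\in M_N(\mathbb{C})[x]$ ($n\ge0$) are the monic (leading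 coefficient the identity) orthogonal polynomials of degree $n$: $\langle P_n^{(\alpha,\nu)},P_m^{(\alpha,\nu)}\rangle^{(\alpha,\nu)}=0$ for $n\neq m$. $\Phi^{(\alpha,\nu)}(x)=(W^{(\alpha,\nu)}_\mu(x))^{-1}W^{(\alpha,\nu+1)}_\mu(x)$ and $\Psi^{(\alpha,\nu)}(x)=(W^{(\alpha,\nu)}_\mu(x))^{-1}\frac{dW^{(\alpha,\nu+1)}_\mu}{dx}(x)$; under the stated conditions these are matrix valued polynomials in $x$. *)

theory Defs
  imports
    "HOL-Analysis.Analysis"
    "HOL-Computational_Algebra.Formal_Power_Series"
    "Jordan_Normal_Form.Gauss_Jordan_Elimination"
    "Jordan_Normal_Form.Schur_Decomposition"
begin

text \<open>
  Rows and columns are numbered \<open>1, \<dots>, N\<close> in the mathematics and \<open>0, \<dots>, N - 1\<close> in \<open>mat\<close>.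
  The sequences \<open>\<mu>\<close> and \<open>\<delta> \<nu>\<close> keep the numbering from \<open>1\<close>, so the matrix row
  \<open>i\<close> uses \<open>\<mu> (Suc i)\<close> and \<open>\<delta> \<nu> (Suc i)\<close>.
\<close>

text \<open>
  The generating function \<open>(1 - t) powr (-1 - a) * exp (x t / (t - 1))\<close> as a formal power
  series in \<open>t\<close>; \<open>fps_binomial b\<close> is \<open>(1 + t) powr b\<close>.
\<close>

definition laguerre :: "real \<Rightarrow> nat \<Rightarrow> real \<Rightarrow> real" where
  "laguerre a n x =
     fps_nth (fps_compose (fps_binomial (- 1 - a)) (- fps_X)
              * fps_compose (fps_exp x) (fps_X / (fps_X - 1))) n"

definition Lmat :: "nat \<Rightarrow> (nat \<Rightarrow> real) \<Rightarrow> real \<Rightarrow> real \<Rightarrow> complex mat" where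
  "Lmat N \<mu> \<alpha> x = mat N N (\<lambda>(i, j).
     if i \<ge> j
     then complex_of_real (\<mu> (Suc i) / \<mu> (Suc j) * laguerre (\<alpha> + real (Suc j)) (i - j) x)
     else 0)"

definition Amat :: "nat \<Rightarrow> (nat \<Rightarrow> real) \<Rightarrow> complex mat" where
  "Amat N \<mu> = mat N N (\<lambda>(i, j).
     if i = Suc j then complex_of_real (- (\<mu> (Suc i) / \<mu> (Suc j))) else 0)"

definition Jmat :: "nat \<Rightarrow> complex mat" where
  "Jmat N = mat N N (\<lambda>(i, j). if i = j then of_nat (Suc i) else 0)"

definition Tmat :: "nat \<Rightarrow> (real \<Rightarrow> nat \<Rightarrow> real) \<Rightarrow> real \<Rightarrow> real \<Rightarrow> complex mat" where
  "Tmat N \<delta> \<nu> x = mat N N (\<lambda>(i, j).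
     if i = j then complex_of_real (exp (- x) * x powr (\<nu> + real (Suc i)) * \<delta> \<nu> (Suc i)) else 0)"

definition Wmat :: "nat \<Rightarrow> (nat \<Rightarrow> real) \<Rightarrow> (real \<Rightarrow> nat \<Rightarrow> real) \<Rightarrow> real \<Rightarrow> real \<Rightarrow> real \<Rightarrow> complex mat" where
  "Wmat N \<mu> \<delta> \<alpha> \<nu> x = Lmat N \<mu> \<alpha> x * Tmat N \<delta> \<nu> x * mat_adjoint (Lmat N \<mu> \<alpha> x)"

text \<open>
  A matrix valued polynomial is a matrix over \<open>complex poly\<close>, with \<open>M\<^sub>N(\<complex>)[x]\<close> identified
  with \<open>M\<^sub>N(\<complex>[x])\<close>.
\<close>

definition matpoly_eval :: "complex poly mat \<Rightarrow> real \<Rightarrow> complex mat" where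
  "matpoly_eval P x = map_mat (\<lambda>p. poly p (complex_of_real x)) P"

definition matpoly_coeff :: "complex poly mat \<Rightarrow> nat \<Rightarrow> complex mat" where
  "matpoly_coeff P k = map_mat (\<lambda>p. coeff p k) P"

definition matpoly_deriv :: "complex poly mat \<Rightarrow> complex poly mat" where
  "matpoly_deriv P = map_mat pderiv P"

definition mat_deriv :: "nat \<Rightarrow> (real \<Rightarrow> complex mat) \<Rightarrow> real \<Rightarrow> complex mat" where
  "mat_deriv N F x = mat N N (\<lambda>(i, j). vector_derivative (\<lambda>t. F t $$ (i, j)) (at x))"

text \<open>
  The pairing takes functions of \<open>x\<close>, because the operator \<open>Sop\<close> below yields a function
  on the positive reals, not a formal polynomial.
\<close>

definition pairing ::
  "nat \<Rightarrow> (real \<Rightarrow> complex mat) \<Rightarrow> (real \<Rightarrow> complex mat) \<Rightarrow> (real \<Rightarrow> complex mat) \<Rightarrow> complex mat" where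
  "pairing N W F G = mat N N (\<lambda>(i, j).
     set_lebesgue_integral lborel {0<..} (\<lambda>x. (F x * W x * mat_adjoint (G x)) $$ (i, j)))"

definition monic_of_degree :: "nat \<Rightarrow> nat \<Rightarrow> complex poly mat \<Rightarrow> bool" where
  "monic_of_degree N n P \<longleftrightarrow>
     P \<in> carrier_mat N N \<and> matpoly_coeff P n = 1\<^sub>m N \<and> (\<forall>k>n. matpoly_coeff P k = 0\<^sub>m N N)"

definition monic_orthogonal :: "nat \<Rightarrow> (real \<Rightarrow> complex mat) \<Rightarrow> (nat \<Rightarrow> complex poly mat) \<Rightarrow> bool" where
  "monic_orthogonal N W P \<longleftrightarrow>
     (\<forall>n. monic_of_degree N n (P n)) \<and>
     (\<forall>n m. n \<noteq> m \<longrightarrow> pairing N W (matpoly_eval (P n)) (matpoly_eval (P m)) = 0\<^sub>m N N)"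

abbreviation minv :: "complex mat \<Rightarrow> complex mat" where
  "minv A \<equiv> the (mat_inverse A)"

definition Phi :: "nat \<Rightarrow> (nat \<Rightarrow> real) \<Rightarrow> (real \<Rightarrow> nat \<Rightarrow> real) \<Rightarrow> real \<Rightarrow> real \<Rightarrow> real \<Rightarrow> complex mat" where
  "Phi N \<mu> \<delta> \<alpha> \<nu> x = minv (Wmat N \<mu> \<delta> \<alpha> \<nu> x) * Wmat N \<mu> \<delta> \<alpha> (\<nu> + 1) x"

definition Psi :: "nat \<Rightarrow> (nat \<Rightarrow> real) \<Rightarrow> (real \<Rightarrow> nat \<Rightarrow> real) \<Rightarrow> real \<Rightarrow> real \<Rightarrow> real \<Rightarrow> complex mat" where
  "Psi N \<mu> \<delta> \<alpha> \<nu> x = minv (Wmat N \<mu> \<delta> \<alpha> \<nu> x) * mat_deriv N (Wmat N \<mu> \<delta> \<alpha> (\<nu> + 1)) x"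

definition Sop ::
  "nat \<Rightarrow> (nat \<Rightarrow> real) \<Rightarrow> (real \<Rightarrow> nat \<Rightarrow> real) \<Rightarrow> real \<Rightarrow> real \<Rightarrow> complex poly mat \<Rightarrow> real \<Rightarrow> complex mat" where
  "Sop N \<mu> \<delta> \<alpha> \<nu> Q x =
     matpoly_eval (matpoly_deriv Q) x * mat_adjoint (Phi N \<mu> \<delta> \<alpha> \<nu> x)
     + matpoly_eval Q x * mat_adjoint (Psi N \<mu> \<delta> \<alpha> \<nu> x)"

end

theory Submission
  imports Defs
begin

text \<open>
  Expanding the generating function gives \<open>L(x) = L(0) exp(x A)\<close>, so the weight is
  \<open>exp(-x) x powr \<nu>\<close> times the matrix polynomial \<open>M = L D L\<^sup>*\<close> with
  \<open>D = diag(\<delta>\<^sub>k x\<^sup>k)\<close>. The condition on \<open>\<mu>\<close> says that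
  \<open>B = T\<^sup>(\<^sup>\<nu>\<^sup>+\<^sup>1\<^sup>) A\<^sup>* (T\<^sup>(\<^sup>\<nu>\<^sup>))\<^sup>-\<^sup>1\<close> spans, together with \<open>A\<close> and \<open>2 J - N - 1\<close>, a copy of \<open>sl\<^sub>2\<close>;
  conjugating by \<open>exp(x A)\<close> then turns \<open>\<Phi>\<^sup>*\<close> and \<open>\<Psi>\<^sup>*\<close> into matrix polynomials of degree
  two and one with explicit coefficients. Adjointness of \<open>d/dx\<close> and \<open>- S\<close> is integration by
  parts. Hence \<open>P\<^sub>n'\<close> is orthogonal for the parameter \<open>\<nu> + 1\<close> to everything of degree below
  \<open>n - 1\<close>, and \<open>P\<^sub>n\<^sub>-\<^sub>1 S\<close> is orthogonal for \<open>\<nu>\<close> to everything of degree below \<open>n\<close>. Positive definiteness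
  identifies both with multiples of the monic orthogonal polynomials, and comparing leading
  coefficients gives \<open>n\<close> and \<open>K\<^sub>n\<close>.
\<close>

section \<open>Laguerre polynomials\<close>

lemma laguerre_at_0: "laguerre a n 0 = fps_nth (fps_compose (fps_binomial (- 1 - a)) (- fps_X)) n"
  by (simp add: laguerre_def)

lemma laguerre_0 [simp]: "laguerre a 0 x = 1"
  by (simp add: laguerre_def)

text \<open>Composition with \<open>- fps_X\<close> is multiplicative, and
  \<open>inverse (1 - fps_X)\<close> is itself the binomial series of exponent \<open>- 1\<close>
  composed with \<open>- fps_X\<close>; so the exponents add.\<close>

lemma fps_binomial_compose_shift:
  fixes b :: real
  shows "fps_compose (fps_binomial b) (- fps_X) * inverse (1 - fps_X) ^ j
         = fps_compose (fps_binomial (b - real j)) (- fps_X)"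
proof -
  have "inverse (1 - fps_X :: real fps) = fps_compose (fps_binomial (- 1)) (- fps_X)"
    by (simp add: fps_binomial_minus_one fps_inverse_compose fps_compose_add_distrib)
  hence "inverse (1 - fps_X :: real fps) ^ j = fps_compose (fps_binomial (- real j)) (- fps_X)"
    by (simp add: fps_compose_power fps_binomial_power)
  thus ?thesis
    by (simp add: fps_compose_mult_distrib[symmetric] fps_binomial_add_mult[symmetric])
qed

text \<open>With \<open>u = - t / (1 - t)\<close>, the \<open>j\<close>-th term of
  \<open>exp(x u)\<close> times \<open>(1 - t) powr (-1 - a)\<close> is \<open>(- x)^j / j!\<close>
  times \<open>t^j (1 - t) powr (-1 - (a + j))\<close>, and the last power is again a Laguerre
  generating function at \<open>0\<close>.\<close>

lemma laguerre_expand: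
  "laguerre a n x = (\<Sum>j\<le>n. laguerre (a + real j) (n - j) 0 * ((- x) ^ j / fact j))"
proof -
  define u :: "real fps" where "u = fps_X / (fps_X - 1)"
  define B :: "real \<Rightarrow> real fps" where "B = (\<lambda>b. fps_compose (fps_binomial b) (- fps_X))"
  have u: "u = - fps_X * inverse (1 - fps_X)"
  proof -
    have "inverse (fps_X - 1 :: real fps) = inverse (- (1 - fps_X))" by simp
    also have "\<dots> = - inverse (1 - fps_X)" by (rule fps_inverse_minus)
    finally show ?thesis by (simp add: u_def fps_divide_unit)
  qed
  have pw: "B (- 1 - a) * u ^ j = fps_const ((- 1) ^ j) * (fps_X ^ j * B (- 1 - (a + real j)))" for j
  proof -
    have "B (- 1 - a) * u ^ j = (- fps_X) ^ j * (B (- 1 - a) * inverse (1 - fps_X) ^ j)"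
      unfolding u power_mult_distrib by (simp only: mult_ac)
    also have "\<dots> = (- fps_X) ^ j * B (- 1 - a - real j)"
      unfolding B_def fps_binomial_compose_shift ..
    also have "(- fps_X :: real fps) ^ j = fps_const ((- 1) ^ j) * fps_X ^ j"
      by (subst power_minus) (simp flip: fps_const_power fps_const_neg)
    finally show ?thesis by (simp add: mult.assoc diff_diff_eq)
  qed
  have uz: "fps_nth (u ^ j) k = 0" if "k < j" for j k
    using startsby_zero_power_prefix[of u j] that by (simp add: u)
  \<comment> \<open>The sum runs to \<open>n\<close> instead of \<open>k\<close>: the extra powers
    of \<open>u\<close> have no coefficient at \<open>k\<close>, and a bound that does not depend on
    \<open>k\<close> allows the two sums to be exchanged.\<close>
  have ex: "fps_nth (fps_compose (fps_exp x) u) k = (\<Sum>j\<le>n. x ^ j / fact j * fps_nth (u ^ j) k)"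
    if "k \<le> n" for k
    unfolding fps_compose_nth using that uz
    by (intro sum.mono_neutral_cong_left) (auto simp: not_le)
  have "laguerre a n x = (\<Sum>i=0..n. fps_nth (B (- 1 - a)) i * fps_nth (fps_compose (fps_exp x) u) (n - i))"
    by (simp add: laguerre_def fps_mult_nth B_def u_def)
  also have "\<dots> = (\<Sum>i=0..n. \<Sum>j\<le>n. x ^ j / fact j * (fps_nth (B (- 1 - a)) i * fps_nth (u ^ j) (n - i)))"
    by (intro sum.cong refl) (simp add: ex sum_distrib_left mult_ac)
  also have "\<dots> = (\<Sum>j\<le>n. x ^ j / fact j * fps_nth (B (- 1 - a) * u ^ j) n)"
    by (subst sum.swap) (simp add: fps_mult_nth sum_distrib_left)
  also have "\<dots> = (\<Sum>j\<le>n. laguerre (a + real j) (n - j) 0 * ((- x) ^ j / fact j))"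
    by (intro sum.cong refl)
       (simp add: pw fps_X_power_mult_nth laguerre_at_0 power_minus[of x], simp add: B_def)
  finally show ?thesis .
qed


section \<open>Integration against the scalar Laguerre weight\<close>

definition lagint :: "real \<Rightarrow> complex poly \<Rightarrow> complex" where
  "lagint s p = set_lebesgue_integral lborel {0<..}
     (\<lambda>x. complex_of_real (exp (- x) * x powr s) * poly p (complex_of_real x))"

lemma has_bochner_integral_Gamma:
  assumes "s > - 1"
  shows "has_bochner_integral lborel
    (\<lambda>x. indicator {0<..} x *\<^sub>R (exp (- x) * x powr s * x ^ k)) (Gamma (s + real k + 1))"
proof -
  have pos: "s + real k + 1 > 0" using assms by simp
  \<comment> \<open>The two integrands agree at \<open>x = 0\<close> as well, since
    \<open>0 powr z = 0\<close>.\<close>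
  have eq: "indicator {0<..} x *\<^sub>R (exp (- x) * x powr s * x ^ k)
      = indicator {0..} x * x powr (s + real k + 1 - 1) / exp x" for x :: real
    by (auto simp: indicator_def powr_add powr_realpow exp_minus field_simps)
  show ?thesis unfolding eq
    by (rule has_bochner_integral_nn_integral)
       (use pos Gamma_conv_nn_integral_real[OF pos] in \<open>auto intro!: less_imp_le Gamma_real_pos\<close>)
qed

lemma has_bochner_integral_lagint:
  assumes "s > - 1" "degree p \<le> n"
  shows "has_bochner_integral lborel
    (\<lambda>x. indicator {0<..} x *\<^sub>R (complex_of_real (exp (- x) * x powr s) * poly p (complex_of_real x)))
    (\<Sum>k\<le>n. coeff p k * complex_of_real (Gamma (s + real k + 1)))"
proof -
  have poly: "poly p z = (\<Sum>k\<le>n. coeff p k * z ^ k)" for z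
    unfolding poly_altdef using assms(2)
    by (intro sum.mono_neutral_left) (auto simp: coeff_eq_0)
  have eq: "indicator {0<..} x *\<^sub>R (complex_of_real (exp (- x) * x powr s) * poly p (complex_of_real x))
      = (\<Sum>k\<le>n. coeff p k * complex_of_real (indicator {0<..} x *\<^sub>R (exp (- x) * x powr s * x ^ k)))" for x
    by (simp add: poly sum_distrib_left scaleR_conv_of_real mult_ac)
  show ?thesis unfolding eq
    by (intro has_bochner_integral_sum has_bochner_integral_mult_right
              has_bochner_integral_of_real has_bochner_integral_Gamma assms)
qed

lemma integrable_lagint:
  assumes "s > - 1"
  shows "set_integrable lborel {0<..}
    (\<lambda>x. complex_of_real (exp (- x) * x powr s) * poly p (complex_of_real x))"
  unfolding set_integrable_def
  using has_bochner_integral_lagint[OF assms order_refl] by (simp add: has_bochner_integral_iff)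

lemma lagint_eq_sum:
  assumes "s > - 1" "degree p \<le> n"
  shows "lagint s p = (\<Sum>k\<le>n. coeff p k * complex_of_real (Gamma (s + real k + 1)))"
  unfolding lagint_def set_lebesgue_integral_def
  using has_bochner_integral_lagint[OF assms] by (rule has_bochner_integral_integral_eq)

lemma lagint_0 [simp]: "lagint s 0 = 0"
  by (simp add: lagint_def)

lemma lagint_add:
  assumes "s > - 1" shows "lagint s (p + q) = lagint s p + lagint s q"
  unfolding lagint_def
  using set_integral_add(2)[OF integrable_lagint[OF assms, of p] integrable_lagint[OF assms, of q]]
  by (simp add: algebra_simps)

lemma lagint_mult_const: "lagint s ([:c:] * p) = c * lagint s p" "lagint s (p * [:c:]) = lagint s p * c"
  by (simp_all add: lagint_def mult.left_commute mult.commute[of _ c])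

lemma lagint_sum:
  assumes "s > - 1" shows "lagint s (sum f A) = (\<Sum>a\<in>A. lagint s (f a))"
  by (induction A rule: infinite_finite_induct) (simp_all add: lagint_add[OF assms])

lemma lagint_uminus: "lagint s (- p) = - lagint s p"
  using lagint_mult_const(1)[of s "- 1" p] by simp

lemma lagint_diff:
  assumes "s > - 1" shows "lagint s (p - q) = lagint s p - lagint s q"
  using lagint_add[OF assms, of p "- q"] by (simp add: lagint_uminus)

text \<open>The extra power of \<open>x\<close> moves into the polynomial, so pairings for
  \<open>\<nu> + 1\<close> and for \<open>\<nu>\<close> become values of the same
  functional.\<close>

lemma lagint_plus_1: "lagint (s + 1) p = lagint s ([:0, 1:] * p)"
  unfolding lagint_def set_lebesgue_integral_def
  by (intro Bochner_Integration.integral_cong refl) (auto simp: indicator_def powr_add mult_ac)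

text \<open>On monomials this is the functional equation of the Gamma function.\<close>

lemma lagint_by_parts:
  assumes "s > - 1"
  shows "lagint s ([:0, 1:] * pderiv p + [:of_real (s + 1), - 1:] * p) = 0"
proof -
  have mono: "lagint s ([:0, 1:] * pderiv (monom a k) + [:of_real (s + 1), - 1:] * monom a k) = 0" for a k
  proof -
    have eq: "[:0, 1:] * pderiv (monom a k) + [:of_real (s + 1), - 1:] * monom a k
        = monom (a * of_real (s + 1 + real k)) k - monom a (Suc k)"
      by (rule poly_eqI)
         (auto simp: pderiv_monom coeff_pCons algebra_simps split: nat.splits)
    have "lagint s (monom b j) = b * of_real (Gamma (s + real j + 1))" for b j
      using lagint_eq_sum[OF assms degree_monom_le, of b j] 
      by (simp add: if_distrib[of "\<lambda>u. u * _"] cong: if_cong)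
    moreover have "Gamma (s + real k + 1 + 1) = (s + real k + 1) * Gamma (s + real k + 1)"
      using assms by (intro Gamma_plus1) (auto dest: nonpos_Ints_nonpos)
    ultimately show ?thesis
      unfolding eq by (simp add: lagint_diff[OF assms] algebra_simps)
  qed
  have "[:0, 1:] * pderiv p + [:of_real (s + 1), - 1:] * p =
     (\<Sum>k\<le>degree p. [:0, 1:] * pderiv (monom (coeff p k) k) + [:of_real (s + 1), - 1:] * monom (coeff p k) k)"
    unfolding sum.distrib sum_distrib_left[symmetric]
    by (subst (1 3) poly_as_sum_of_monoms[symmetric]) (simp add: pderiv_sum)
  thus ?thesis by (simp only: lagint_sum[OF assms] mono) simp
qed

text \<open>A nonnegative integrand with zero integral vanishes almost everywhere. If
  \<open>p\<close> were nonzero, its finitely many real roots would form a null set, and the half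
  line would be null as well.\<close>

lemma lagint_pos_def:
  assumes "s > - 1" and nn: "\<And>x. x > 0 \<Longrightarrow> \<exists>r\<ge>0. poly p (complex_of_real x) = complex_of_real r"
    and "lagint s p = 0"
  shows "p = 0"
proof (rule ccontr)
  assume "p \<noteq> 0"
  define f where "f = (\<lambda>x. indicator {0<..} x *\<^sub>R
    (complex_of_real (exp (- x) * x powr s) * poly p (complex_of_real x)))"
  have int: "integrable lborel f"
    using integrable_lagint[OF assms(1), of p] by (simp add: f_def set_integrable_def)
  have nn': "Re (f x) \<ge> 0" for x
    using nn[of x] by (auto simp: f_def indicator_def)
  have "integral\<^sup>L lborel (\<lambda>x. Re (f x)) = Re (integral\<^sup>L lborel f)"
    using int by simp
  also have "\<dots> = 0"
    using assms(3) by (simp add: lagint_def set_lebesgue_integral_def f_def)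
  finally have ae: "AE x in lborel. Re (f x) = 0"
    using int nn' by (subst (asm) integral_nonneg_eq_0_iff_AE) auto
  have "finite (complex_of_real -` {z. poly p z = 0})"
    using \<open>p \<noteq> 0\<close> by (intro finite_vimageI poly_roots_finite) (auto simp: inj_def)
  hence "AE x in lborel. x \<notin> complex_of_real -` {z. poly p z = 0}"
    by (intro AE_not_in finite_imp_null_set_lborel)
  with ae have "AE x in lborel. x \<notin> {0::real<..}"
  proof eventually_elim
    case (elim x)
    with nn[of x] show ?case by (auto simp: f_def)
  qed
  hence "emeasure lborel {0::real<..} = 0"
    by (subst (asm) AE_iff_null_sets[symmetric]) auto
  moreover have "emeasure lborel {0::real<..<1} \<le> emeasure lborel {0::real<..}"
    by (intro emeasure_mono) auto
  ultimately show False by simp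
qed


section \<open>Matrix valued polynomials\<close>

interpretation cnj_hom: field_hom cnj
  by unfold_locales auto

interpretation cnj_poly_hom: map_poly_comm_ring_hom cnj ..

lemma poly_map_poly_cnj: "poly (map_poly cnj p) z = cnj (poly p (cnj z))"
  by (induction p) (simp_all add: map_poly_pCons)

lemma map_poly_cnj_cnj [simp]: "map_poly cnj (map_poly cnj p) = p"
  by (rule poly_eqI) (simp add: coeff_map_poly)

lemma mat_adjoint_dim [simp]:
  "dim_row (mat_adjoint A) = dim_col A" "dim_col (mat_adjoint A) = dim_row A"
  by (simp_all add: mat_adjoint_def)

lemma mat_adjoint_carrier [simp]: "mat_adjoint A \<in> carrier_mat n m \<longleftrightarrow> A \<in> carrier_mat m n"
  by (metis carrier_matD carrier_matI mat_adjoint_dim)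

lemma mat_adjoint_index [simp]:
  fixes A :: "complex mat"
  shows "i < dim_col A \<Longrightarrow> j < dim_row A \<Longrightarrow> mat_adjoint A $$ (i, j) = cnj (A $$ (j, i))"
  by (simp add: mat_adjoint_def mat_of_rows_index)

lemma mat_adjoint_adjoint [simp]: "mat_adjoint (mat_adjoint A) = (A :: complex mat)"
  by (intro eq_matI) auto

definition pconst :: "complex mat \<Rightarrow> complex poly mat" where
  "pconst = map_mat (\<lambda>c. [:c:])"

text \<open>Coefficients are conjugated but the variable is not, so evaluation at real points turns
  \<open>padj\<close> into the matrix adjoint.\<close>

definition padj :: "complex poly mat \<Rightarrow> complex poly mat" where
  "padj P = map_mat (map_poly cnj) (transpose_mat P)"

lemma pconst_carrier [simp]: "pconst A \<in> carrier_mat n m \<longleftrightarrow> A \<in> carrier_mat n m"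
  by (simp add: pconst_def)

lemma padj_dim [simp]: "dim_row (padj A) = dim_col A" "dim_col (padj A) = dim_row A"
  by (simp_all add: padj_def)

lemma padj_carrier [simp]: "padj A \<in> carrier_mat n m \<longleftrightarrow> A \<in> carrier_mat m n"
  by (metis carrier_matD carrier_matI padj_dim)

lemma matpoly_eval_carrier [simp]: "matpoly_eval A x \<in> carrier_mat n m \<longleftrightarrow> A \<in> carrier_mat n m"
  by (simp add: matpoly_eval_def)

lemma matpoly_deriv_carrier [simp]: "matpoly_deriv A \<in> carrier_mat n m \<longleftrightarrow> A \<in> carrier_mat n m"
  by (simp add: matpoly_deriv_def)

lemma matpoly_coeff_carrier [simp]: "matpoly_coeff A k \<in> carrier_mat n m \<longleftrightarrow> A \<in> carrier_mat n m"
  by (simp add: matpoly_coeff_def)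

lemma pconst_mult:
  "A \<in> carrier_mat n m \<Longrightarrow> B \<in> carrier_mat m k \<Longrightarrow> pconst (A * B) = pconst A * pconst B"
  unfolding pconst_def by (intro eq_matI) (auto simp: scalar_prod_def mult.commute sum_to_poly)

lemma pconst_one: "pconst (1\<^sub>m n) = 1\<^sub>m n"
  by (intro eq_matI) (auto simp: pconst_def)

lemma padj_pconst: "padj (pconst A) = pconst (mat_adjoint A)"
  by (intro eq_matI) (auto simp: pconst_def padj_def map_poly_pCons)

lemma padj_padj [simp]: "padj (padj A) = A"
  by (intro eq_matI) (auto simp: padj_def)

lemma padj_mult:
  assumes "A \<in> carrier_mat n m" "B \<in> carrier_mat m k"
  shows "padj (A * B) = padj B * padj A"
  unfolding padj_def using assms
  by (simp add: transpose_mult[OF assms] cnj_poly_hom.mat_hom_mult[of _ k m _ n])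

lemma padj_add:
  assumes "A \<in> carrier_mat n m" "B \<in> carrier_mat n m"
  shows "padj (A + B) = padj A + padj B"
  unfolding padj_def using assms by (intro eq_matI) auto

lemma padj_diff:
  assumes "A \<in> carrier_mat n m" "B \<in> carrier_mat n m"
  shows "padj (A - B) = padj A - padj B"
  unfolding padj_def using assms by (intro eq_matI) auto

lemma padj_smult: "padj (p \<cdot>\<^sub>m A) = map_poly cnj p \<cdot>\<^sub>m padj A"
  unfolding padj_def by (intro eq_matI) auto

lemma matpoly_eval_mult:
  assumes "A \<in> carrier_mat n m" "B \<in> carrier_mat m k"
  shows "matpoly_eval (A * B) x = matpoly_eval A x * matpoly_eval B x"
  unfolding matpoly_eval_def using assms
  by (intro eq_matI) (auto simp: scalar_prod_def poly_sum)

lemma matpoly_eval_add: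
  assumes "A \<in> carrier_mat n m" "B \<in> carrier_mat n m"
  shows "matpoly_eval (A + B) x = matpoly_eval A x + matpoly_eval B x"
  unfolding matpoly_eval_def using assms by (intro eq_matI) auto

lemma matpoly_eval_smult: "matpoly_eval (p \<cdot>\<^sub>m A) x = poly p (of_real x) \<cdot>\<^sub>m matpoly_eval A x"
  unfolding matpoly_eval_def by (intro eq_matI) auto

lemma matpoly_eval_pconst [simp]: "matpoly_eval (pconst A) x = A"
  unfolding matpoly_eval_def pconst_def by (intro eq_matI) auto

lemma matpoly_eval_padj: "matpoly_eval (padj A) x = mat_adjoint (matpoly_eval A x)"
  unfolding matpoly_eval_def padj_def by (intro eq_matI) (auto simp: poly_map_poly_cnj)

text \<open>Otherwise the difference would have infinitely many roots.\<close>

lemma poly_eqI_pos_real: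
  fixes p q :: "complex poly"
  assumes "\<And>x::real. x > 0 \<Longrightarrow> poly p (of_real x) = poly q (of_real x)"
  shows "p = q"
proof (rule ccontr)
  assume "p \<noteq> q"
  hence "finite {z. poly (p - q) z = 0}" by (intro poly_roots_finite) simp
  moreover have "complex_of_real ` {0<..} \<subseteq> {z. poly (p - q) z = 0}" using assms by auto
  ultimately have "finite (complex_of_real ` {0<..})" by (rule finite_subset[rotated])
  hence "finite {0::real<..}" by (rule finite_imageD) (auto simp: inj_on_def)
  thus False by (simp add: infinite_Ioi)
qed

lemma matpoly_eqI:
  assumes "A \<in> carrier_mat n m" "B \<in> carrier_mat n m"
    and "\<And>x. x > 0 \<Longrightarrow> matpoly_eval A x = matpoly_eval B x"
  shows "A = B"
proof (rule eq_matI)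
  fix i j assume "i < dim_row B" "j < dim_col B"
  thus "A $$ (i, j) = B $$ (i, j)"
    using assms(1,2) arg_cong[OF assms(3), of _ "\<lambda>M. M $$ (i, j)"]
    by (intro poly_eqI_pos_real) (auto simp: matpoly_eval_def)
qed (use assms in auto)

lemma matpoly_deriv_mult:
  assumes "A \<in> carrier_mat n m" "B \<in> carrier_mat m k"
  shows "matpoly_deriv (A * B) = matpoly_deriv A * B + A * matpoly_deriv B"
  unfolding matpoly_deriv_def using assms
  by (intro eq_matI) (auto simp: scalar_prod_def pderiv_sum pderiv_mult sum.distrib mult.commute add.commute)

lemma matpoly_deriv_pconst [simp]: "A \<in> carrier_mat n m \<Longrightarrow> matpoly_deriv (pconst A) = 0\<^sub>m n m"
  unfolding matpoly_deriv_def pconst_def by (intro eq_matI) (auto simp: pderiv_pCons)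

lemma pderiv_map_poly_cnj: "pderiv (map_poly cnj p) = map_poly cnj (pderiv p)"
  by (rule poly_eqI) (simp add: coeff_pderiv coeff_map_poly)

lemma matpoly_deriv_padj: "matpoly_deriv (padj A) = padj (matpoly_deriv A)"
  unfolding matpoly_deriv_def padj_def by (intro eq_matI) (auto simp: pderiv_map_poly_cnj)

lemma matpoly_coeff_add:
  assumes "A \<in> carrier_mat n m" "B \<in> carrier_mat n m"
  shows "matpoly_coeff (A + B) k = matpoly_coeff A k + matpoly_coeff B k"
  unfolding matpoly_coeff_def using assms by (intro eq_matI) auto

lemma matpoly_coeff_diff:
  assumes "A \<in> carrier_mat n m" "B \<in> carrier_mat n m"
  shows "matpoly_coeff (A - B) k = matpoly_coeff A k - matpoly_coeff B k"
  unfolding matpoly_coeff_def using assms by (intro eq_matI) auto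

lemma matpoly_coeff_pconst_mult:
  assumes "C \<in> carrier_mat n m" "A \<in> carrier_mat m l"
  shows "matpoly_coeff (pconst C * A) k = C * matpoly_coeff A k"
  unfolding matpoly_coeff_def pconst_def using assms
  by (intro eq_matI) (auto simp: scalar_prod_def coeff_sum)

lemma matpoly_coeff_mult_pconst:
  assumes "A \<in> carrier_mat n m" "C \<in> carrier_mat m l"
  shows "matpoly_coeff (A * pconst C) k = matpoly_coeff A k * C"
  unfolding matpoly_coeff_def pconst_def using assms
  by (intro eq_matI) (auto simp: scalar_prod_def coeff_sum mult.commute)

lemma matpoly_coeff_smult_const: "matpoly_coeff ([:c:] \<cdot>\<^sub>m A) k = c \<cdot>\<^sub>m matpoly_coeff A k"
  unfolding matpoly_coeff_def by (intro eq_matI) auto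

lemma matpoly_coeff_smult_X:
  "matpoly_coeff ([:0, 1:] \<cdot>\<^sub>m A) (Suc k) = matpoly_coeff A k"
  unfolding matpoly_coeff_def by (intro eq_matI) auto

lemma matpoly_coeff_deriv:
  "matpoly_coeff (matpoly_deriv A) k = of_nat (Suc k) \<cdot>\<^sub>m matpoly_coeff A (Suc k)"
  unfolding matpoly_coeff_def matpoly_deriv_def by (intro eq_matI) (auto simp: coeff_pderiv)

lemma matpoly_eq_iff_coeff:
  assumes "A \<in> carrier_mat n m" "B \<in> carrier_mat n m"
  shows "A = B \<longleftrightarrow> (\<forall>k. matpoly_coeff A k = matpoly_coeff B k)"
proof
  assume *: "\<forall>k. matpoly_coeff A k = matpoly_coeff B k"
  show "A = B"
  proof (rule eq_matI)
    fix i j assume "i < dim_row B" "j < dim_col B"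
    thus "A $$ (i, j) = B $$ (i, j)"
      using assms arg_cong[OF spec[OF *], where f = "\<lambda>M. M $$ (i, j)"]
      by (intro poly_eqI) (auto simp: matpoly_coeff_def)
  qed (use assms in auto)
qed simp

text \<open>\<open>minv\<close> is meaningful only if \<open>mat_inverse\<close> does not return
  \<open>None\<close>; a nonzero determinant guarantees this.\<close>

lemma minv:
  assumes "A \<in> carrier_mat n n" "det A \<noteq> 0"
  shows "A * minv A = 1\<^sub>m n" "minv A * A = 1\<^sub>m n" "minv A \<in> carrier_mat n n"
proof -
  have "mat_inverse A \<noteq> None"
    using mat_inverse(1)[OF assms(1), where b = "()"] det_non_zero_imp_unit[OF assms, where b = "()"] by blast
  then obtain B where "mat_inverse A = Some B" by auto
  with mat_inverse(2)[OF assms(1) this]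
  show "A * minv A = 1\<^sub>m n" "minv A * A = 1\<^sub>m n" "minv A \<in> carrier_mat n n" by auto
qed

section \<open>Tridiagonal matrices\<close>

definition tri :: "(nat \<Rightarrow> 'a) \<Rightarrow> (nat \<Rightarrow> 'a) \<Rightarrow> (nat \<Rightarrow> 'a) \<Rightarrow> nat \<Rightarrow> nat \<Rightarrow> 'a :: comm_ring_1" where
  "tri a b c i j = (if i = Suc j then a i else if i = j then b i else if j = Suc i then c i else 0)"

lemma sum_delta_Suc:
  fixes f :: "nat \<Rightarrow> 'a :: comm_monoid_add"
  shows "i < N \<Longrightarrow> (\<Sum>k\<in>{0..<N}. if i = Suc k then f k else 0) = (if i > 0 then f (i - 1) else 0)"
  by (cases i) auto

lemma sum_tri_left:
  assumes "i < N"
  shows "(\<Sum>k\<in>{0..<N}. tri a b c i k * f k) =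
     (if i > 0 then a i * f (i - 1) else 0) + b i * f i + (if Suc i < N then c i * f (Suc i) else 0)"
proof -
  have "(\<Sum>k\<in>{0..<N}. tri a b c i k * f k) = (\<Sum>k\<in>{0..<N}. (if i = Suc k then a i * f k else 0)
      + (if k = i then b i * f k else 0) + (if k = Suc i then c i * f k else 0))"
    by (intro sum.cong refl) (auto simp: tri_def)
  thus ?thesis
    using assms sum_delta_Suc[of i N "\<lambda>k. a i * f k"] by (simp add: sum.distrib)
qed

text \<open>All three bands of \<open>tri\<close> are indexed by the row, so in a column sum the
  off-diagonal bands appear at the shifted indices \<open>Suc j\<close> and
  \<open>j - 1\<close>.\<close>

lemma sum_tri_right:
  assumes "j < N"
  shows "(\<Sum>k\<in>{0..<N}. f k * tri a b c k j) =
     (if Suc j < N then f (Suc j) * a (Suc j) else 0) + f j * b j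
       + (if j > 0 then f (j - 1) * c (j - 1) else 0)"
proof -
  have "(\<Sum>k\<in>{0..<N}. f k * tri a b c k j) = (\<Sum>k\<in>{0..<N}. (if k = Suc j then f k * a k else 0)
      + (if k = j then f k * b k else 0) + (if j = Suc k then f k * c k else 0))"
    by (intro sum.cong refl) (auto simp: tri_def)
  thus ?thesis
    using assms sum_delta_Suc[of j N "\<lambda>k. f k * c k"] by (simp add: sum.distrib)
qed


section \<open>The polynomial part of the weight\<close>

text \<open>
  Conjugation by \<open>diag(\<mu>\<^sub>1, \<dots>, \<mu>\<^sub>N)\<close> removes \<open>\<mu>\<close> from the identities between
  \<open>A\<close>, \<open>exp(x A)\<close> and \<open>B\<close>.
\<close>

definition scaled_mat :: "nat \<Rightarrow> (nat \<Rightarrow> real) \<Rightarrow> (nat \<Rightarrow> nat \<Rightarrow> complex poly) \<Rightarrow> complex poly mat" where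
  "scaled_mat N \<mu> f = mat N N (\<lambda>(i, j). Polynomial.smult (of_real (\<mu> (Suc i) / \<mu> (Suc j))) (f i j))"

lemma scaled_mat_carrier [simp]: "scaled_mat N \<mu> f \<in> carrier_mat N N"
  by (simp add: scaled_mat_def)

lemma scaled_mat_cong:
  "(\<And>i j. i < N \<Longrightarrow> j < N \<Longrightarrow> f i j = g i j) \<Longrightarrow> scaled_mat N \<mu> f = scaled_mat N \<mu> g"
  unfolding scaled_mat_def by (intro eq_matI) auto

text \<open>The intermediate factors \<open>\<mu> (Suc k)\<close> cancel because they are nonzero;
  after that only the unscaled entries matter.\<close>

lemma scaled_mat_mult:
  assumes "\<forall>k\<in>{1..N}. \<mu> k \<noteq> 0"
  shows "scaled_mat N \<mu> f * scaled_mat N \<mu> g = scaled_mat N \<mu> (\<lambda>i j. \<Sum>k\<in>{0..<N}. f i k * g k j)"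
proof (rule eq_matI)
  fix i j assume "i < dim_row (scaled_mat N \<mu> (\<lambda>i j. \<Sum>k\<in>{0..<N}. f i k * g k j))"
    "j < dim_col (scaled_mat N \<mu> (\<lambda>i j. \<Sum>k\<in>{0..<N}. f i k * g k j))"
  hence ij: "i < N" "j < N" by (auto simp: scaled_mat_def)
  have "(scaled_mat N \<mu> f * scaled_mat N \<mu> g) $$ (i, j) = (\<Sum>k\<in>{0..<N}.
     Polynomial.smult (of_real (\<mu> (Suc i) / \<mu> (Suc k))) (f i k) * Polynomial.smult (of_real (\<mu> (Suc k) /
       \<mu> (Suc j))) (g k j))"
    using ij by (simp add: scaled_mat_def scalar_prod_def)
  also have "\<dots> = (\<Sum>k\<in>{0..<N}. Polynomial.smult (of_real (\<mu> (Suc i) / \<mu> (Suc j))) (f i k * g k j))"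
    using assms by (intro sum.cong refl) simp
  also have "\<dots> = scaled_mat N \<mu> (\<lambda>i j. \<Sum>k\<in>{0..<N}. f i k * g k j) $$ (i, j)"
    using ij by (simp add: scaled_mat_def smult_sum2)
  finally show "(scaled_mat N \<mu> f * scaled_mat N \<mu> g) $$ (i, j) = \<dots>" .
qed (simp_all add: scaled_mat_def)

definition gpow :: "nat \<Rightarrow> complex poly" where
  "gpow j = monom ((- 1) ^ j / fact j) j"

lemma gpow_0 [simp]: "gpow 0 = 1"
  by (simp add: gpow_def)

lemma poly_gpow: "poly (gpow j) z = (- z) ^ j / fact j"
  by (simp add: gpow_def poly_monom power_minus[of z])

lemma pderiv_gpow_Suc: "pderiv (gpow (Suc j)) = - gpow j"
  by (rule poly_eqI) (simp add: gpow_def coeff_pderiv field_simps del: of_nat_Suc)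

text \<open>Trades a factor \<open>z\<close> for the next power, so that identities between entries
  reduce to comparing the coefficients of values of \<open>gpow\<close>.\<close>

lemma poly_gpow_rec: "z * poly (gpow j) z = - (of_nat j + 1) * poly (gpow (Suc j)) z"
proof -
  have "of_nat j + 1 \<noteq> (0 :: complex)" by (metis Suc_eq_plus1 of_nat_1 of_nat_add of_nat_neq_0)
  thus ?thesis by (simp add: poly_gpow divide_simps add.commute) (simp add: algebra_simps)
qed

text \<open>Conjugated by the diagonal of \<open>\<mu>\<close>, the matrix \<open>A\<close> becomes
  minus the subdiagonal shift; these are the entries of the exponential of \<open>x\<close> times
  that matrix.\<close>

definition gfun :: "nat \<Rightarrow> nat \<Rightarrow> complex poly" where
  "gfun i j = (if j \<le> i then gpow (i - j) else 0)"

text \<open>\<open>Gmat\<close> is \<open>exp(x A)\<close>.\<close>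

definition Gmat :: "nat \<Rightarrow> (nat \<Rightarrow> real) \<Rightarrow> complex poly mat" where
  "Gmat N \<mu> = scaled_mat N \<mu> gfun"

lemma Gmat_carrier [simp]: "Gmat N \<mu> \<in> carrier_mat N N"
  by (simp add: Gmat_def)

lemma Lmat_carrier [simp]: "Lmat N \<mu> \<alpha> x \<in> carrier_mat N N"
  by (simp add: Lmat_def)

text \<open>This is \<open>laguerre_expand\<close> read entrywise: the ratios of
  \<open>\<mu>\<close> telescope, and the summation index \<open>k = j + l\<close> turns the
  parameter of row \<open>k\<close> into the one shifted by \<open>l\<close>.\<close>

lemma Lmat_eq_Gmat:
  assumes "\<forall>k\<in>{1..N}. \<mu> k \<noteq> 0"
  shows "Lmat N \<mu> \<alpha> x = Lmat N \<mu> \<alpha> 0 * matpoly_eval (Gmat N \<mu>) x"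
proof (rule eq_matI)
  fix i j assume "i < dim_row (Lmat N \<mu> \<alpha> 0 * matpoly_eval (Gmat N \<mu>) x)"
    "j < dim_col (Lmat N \<mu> \<alpha> 0 * matpoly_eval (Gmat N \<mu>) x)"
  hence ij: "i < N" "j < N" by (auto simp: Lmat_def matpoly_eval_def Gmat_def scaled_mat_def)
  have "(Lmat N \<mu> \<alpha> 0 * matpoly_eval (Gmat N \<mu>) x) $$ (i, j) =
    (\<Sum>k\<in>{0..<N}. (if k \<le> i then complex_of_real (\<mu> (Suc i) / \<mu> (Suc k) * laguerre (\<alpha>
      + real (Suc k)) (i - k) 0) else 0) *
       (if j \<le> k then complex_of_real (\<mu> (Suc k) / \<mu> (Suc j) * ((- x) ^ (k - j) / fact (k - j))) else 0))"
    using ij by (auto simp: Lmat_def matpoly_eval_def Gmat_def scaled_mat_def scalar_prod_def gfun_def poly_gpow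
        intro!: sum.cong)
  also have "\<dots> = (\<Sum>k\<in>{j..i}. complex_of_real (\<mu> (Suc i) / \<mu> (Suc j) *
      (laguerre (\<alpha> + real (Suc k)) (i - k) 0 * ((- x) ^ (k - j) / fact (k - j)))))"
    using ij assms by (intro sum.mono_neutral_cong_right) auto
  also have "\<dots> = Lmat N \<mu> \<alpha> x $$ (i, j)"
  proof (cases "j \<le> i")
    case True
    have "(\<Sum>k\<in>{j..i}. complex_of_real (\<mu> (Suc i) / \<mu> (Suc j) *
      (laguerre (\<alpha> + real (Suc k)) (i - k) 0 * ((- x) ^ (k - j) / fact (k - j))))) =
       (\<Sum>l\<le>i - j. complex_of_real (\<mu> (Suc i) / \<mu> (Suc j) *
      (laguerre (\<alpha> + real (Suc j) + real l) (i - j - l) 0 * ((- x) ^ l / fact l))))"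
      using True
      by (intro sum.reindex_bij_witness[of _ "\<lambda>l. l + j" "\<lambda>k. k - j"]) (auto simp: of_nat_diff algebra_simps)
    also have "\<dots> = complex_of_real (\<mu> (Suc i) / \<mu> (Suc j) * laguerre (\<alpha> + real (Suc j)) (i - j) x)"
      by (simp only: laguerre_expand[of _ _ x] sum_distrib_left of_real_sum)
    finally show ?thesis using ij True by (simp add: Lmat_def)
  qed (use ij in \<open>simp add: Lmat_def\<close>)
  finally show "Lmat N \<mu> \<alpha> x $$ (i, j) = (Lmat N \<mu> \<alpha> 0 * matpoly_eval (Gmat N \<mu>) x) $$ (i, j)" ..
qed (simp_all add: Lmat_def matpoly_eval_def Gmat_def scaled_mat_def)

lemma det_Lmat:
  assumes "\<forall>k\<in>{1..N}. \<mu> k \<noteq> 0"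
  shows "det (Lmat N \<mu> \<alpha> x) = 1"
proof -
  have "det (Lmat N \<mu> \<alpha> x) = prod_list (diag_mat (Lmat N \<mu> \<alpha> x))"
    by (rule det_lower_triangular[of N]) (simp_all add: Lmat_def)
  also have "diag_mat (Lmat N \<mu> \<alpha> x) = map (\<lambda>_. 1) [0..<N]"
    using assms by (auto simp: diag_mat_def Lmat_def)
  finally show ?thesis by (simp add: map_replicate_const)
qed

text \<open>The rule \<open>d/dx exp(x A) = exp(x A) A\<close>. Entrywise, differentiating
  \<open>gpow\<close> lowers its index by one, which is what multiplication by the shift
  does.\<close>

lemma matpoly_deriv_Gmat:
  assumes "\<forall>k\<in>{1..N}. \<mu> k \<noteq> 0"
  shows "matpoly_deriv (Gmat N \<mu>) = Gmat N \<mu> * pconst (Amat N \<mu>)"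
proof -
  have A: "pconst (Amat N \<mu>) = scaled_mat N \<mu> (tri (\<lambda>_. - 1) (\<lambda>_. 0) (\<lambda>_. 0))"
    unfolding pconst_def Amat_def scaled_mat_def by (intro eq_matI) (auto simp: tri_def one_pCons)
  have D: "matpoly_deriv (Gmat N \<mu>) = scaled_mat N \<mu> (\<lambda>i j. pderiv (gfun i j))"
    unfolding matpoly_deriv_def Gmat_def scaled_mat_def by (intro eq_matI) (auto simp: pderiv_smult)
  show ?thesis
    unfolding A D unfolding Gmat_def scaled_mat_mult[OF assms]
  proof (rule scaled_mat_cong)
    fix i j assume ij: "i < N" "j < N"
    show "pderiv (gfun i j) = (\<Sum>k = 0..<N. gfun i k * tri (\<lambda>_. - 1) (\<lambda>_. 0) (\<lambda>_. 0) k j)"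
      unfolding sum_tri_right[OF ij(2)]
    proof (cases "j < i")
      case True
      hence "i - j = Suc (i - Suc j)" by simp
      with True ij show "pderiv (gfun i j) = (if Suc j < N then gfun i (Suc j) * - 1 else 0) +
        gfun i j * 0 + (if 0 < j then gfun i (j - 1) * 0 else 0)"
        using pderiv_gpow_Suc[of "i - Suc j"] by (simp add: gfun_def)
    qed (auto simp: gfun_def)
  qed
qed

text \<open>Built from the factorisation and not from the Laguerre entries, so that identities for
  \<open>Gmat\<close> apply directly.\<close>

definition Lpoly :: "nat \<Rightarrow> (nat \<Rightarrow> real) \<Rightarrow> real \<Rightarrow> complex poly mat" where
  "Lpoly N \<mu> \<alpha> = pconst (Lmat N \<mu> \<alpha> 0) * Gmat N \<mu>"

definition Dpoly :: "nat \<Rightarrow> (real \<Rightarrow> nat \<Rightarrow> real) \<Rightarrow> real \<Rightarrow> complex poly mat" where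
  "Dpoly N \<delta> \<nu> = mat_diag N (\<lambda>i. monom (of_real (\<delta> \<nu> (Suc i))) (Suc i))"

definition Mpoly :: "nat \<Rightarrow> (nat \<Rightarrow> real) \<Rightarrow> (real \<Rightarrow> nat \<Rightarrow> real) \<Rightarrow> real \<Rightarrow> real \<Rightarrow> complex poly mat" where
  "Mpoly N \<mu> \<delta> \<alpha> \<nu> = Lpoly N \<mu> \<alpha> * Dpoly N \<delta> \<nu> * padj (Lpoly N \<mu> \<alpha>)"

lemma Mpoly_carrier [simp]: "Lpoly N \<mu> \<alpha> \<in> carrier_mat N N" "Dpoly N \<delta> \<nu> \<in> carrier_mat N N"
    "Mpoly N \<mu> \<delta> \<alpha> \<nu> \<in> carrier_mat N N"
  by (simp_all add: Lpoly_def Dpoly_def Mpoly_def mat_diag_def mult_carrier_mat[of _ N N _ N])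

lemma Dpoly_dim [simp]: "dim_row (Dpoly N \<delta> \<nu>) = N" "dim_col (Dpoly N \<delta> \<nu>) = N"
  by (simp_all add: Dpoly_def mat_diag_def)

lemma matpoly_eval_Lpoly:
  assumes "\<forall>k\<in>{1..N}. \<mu> k \<noteq> 0"
  shows "matpoly_eval (Lpoly N \<mu> \<alpha>) x = Lmat N \<mu> \<alpha> x"
  unfolding Lpoly_def Lmat_eq_Gmat[OF assms, of \<alpha> x] by (simp add: matpoly_eval_mult[of _ N N _ N])

lemma Wmat_eq:
  assumes "\<forall>k\<in>{1..N}. \<mu> k \<noteq> 0" "x > 0"
  shows "Wmat N \<mu> \<delta> \<alpha> \<nu> x = complex_of_real (exp (- x) * x powr \<nu>) \<cdot>\<^sub>m matpoly_eval (Mpoly N \<mu> \<delta> \<alpha> \<nu>) x"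
proof -
  have T: "Tmat N \<delta> \<nu> x = complex_of_real (exp (- x) * x powr \<nu>) \<cdot>\<^sub>m matpoly_eval (Dpoly N \<delta> \<nu>) x"
    using assms(2) unfolding Tmat_def Dpoly_def matpoly_eval_def mat_diag_def
    by (intro eq_matI)
       (auto simp: poly_monom powr_add powr_realpow simp flip: of_real_power of_real_mult)
  show ?thesis
    unfolding Wmat_def T Mpoly_def
    by (simp add: matpoly_eval_mult[of _ N N _ N] mult_carrier_mat[of _ N N _ N] matpoly_eval_padj
        matpoly_eval_Lpoly[OF assms(1)] mult_smult_distrib[of _ N N _ N] mult_smult_assoc_mat[of _ N N _ N])
qed

text \<open>The diagonal factor has real coefficients. Self-adjointness allows the equations for
  \<open>\<Phi>\<close> and \<open>\<Psi>\<close> to be read from either side of the weight.\<close>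

lemma padj_Mpoly: "padj (Mpoly N \<mu> \<delta> \<alpha> \<nu>) = Mpoly N \<mu> \<delta> \<alpha> \<nu>"
proof -
  have "padj (Dpoly N \<delta> \<nu>) = Dpoly N \<delta> \<nu>"
    unfolding padj_def Dpoly_def mat_diag_def by (intro eq_matI) auto
  thus ?thesis
    unfolding Mpoly_def
    by (simp add: padj_mult[of _ N N _ N] mult_carrier_mat[of _ N N _ N] assoc_mult_mat[of _ N N _ N _ N])
qed

lemma matpoly_deriv_Lpoly:
  assumes "\<forall>k\<in>{1..N}. \<mu> k \<noteq> 0"
  shows "matpoly_deriv (Lpoly N \<mu> \<alpha>) = Lpoly N \<mu> \<alpha> * pconst (Amat N \<mu>)"
proof -
  have A: "Amat N \<mu> \<in> carrier_mat N N" by (simp add: Amat_def)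
  show ?thesis unfolding Lpoly_def using A
    by (simp add: matpoly_deriv_mult[of _ N N _ N] matpoly_deriv_Gmat[OF assms] mult_carrier_mat[of _ N N _ N]
        assoc_mult_mat[of _ N N _ N _ N] matpoly_deriv_pconst[of _ N N] left_mult_zero_mat[of _ N N]
          left_add_zero_mat[of _ N N])
qed

lemma mult_Dpoly_index:
  assumes "X \<in> carrier_mat N N" "i < N" "j < N"
  shows "(X * Dpoly N \<delta> \<nu>) $$ (i, j) = X $$ (i, j) * monom (of_real (\<delta> \<nu> (Suc j))) (Suc j)"
  using assms unfolding Dpoly_def by (simp add: mat_diag_mult_right[of _ N])

lemma Dpoly_mult_index:
  assumes "X \<in> carrier_mat N N" "i < N" "j < N"
  shows "(Dpoly N \<delta> \<nu> * X) $$ (i, j) = monom (of_real (\<delta> \<nu> (Suc i))) (Suc i) * X $$ (i, j)"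
  using assms unfolding Dpoly_def by (simp add: mat_diag_mult_left[of _ N])

section \<open>The Pearson equations for one step from \<open>\<nu>\<close> to
  \<open>\<nu> + 1\<close>\<close>

locale laguerre_step =
  fixes N :: nat and \<mu> :: "nat \<Rightarrow> real" and \<delta> :: "real \<Rightarrow> nat \<Rightarrow> real" and \<alpha> \<nu> c d :: real
  assumes \<mu>: "\<forall>k\<in>{1..N}. \<mu> k \<noteq> 0"
    and \<nu>: "\<nu> > 0"
    and \<delta>_pos: "k \<in> {1..N} \<Longrightarrow> \<delta> \<nu> k > 0" "k \<in> {1..N} \<Longrightarrow> \<delta> (\<nu> + 1) k > 0"
    and \<delta>_Suc: "k \<in> {1..N} \<Longrightarrow> \<delta> (\<nu> + 1) k = (d * real k + c) * \<delta> \<nu> k"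
    and \<mu>_ratio: "1 \<le> k \<Longrightarrow> k < N \<Longrightarrow>
      (\<mu> (k + 1))\<^sup>2 / (\<mu> k)\<^sup>2 = d * real k * (real N - real k) * (\<delta> \<nu> (k + 1) / \<delta> (\<nu> + 1) k)"
begin

text \<open>The diagonal matrix \<open>d J + c\<close>, put in the form \<open>scaled_mat\<close>
  (where \<open>\<mu>\<close> cancels on the diagonal) so that it multiplies by the same rules as
  the other factors.\<close>

definition Ediag :: "complex poly mat" where
  "Ediag = scaled_mat N \<mu> (tri (\<lambda>_. 0) (\<lambda>i. [:of_real (d * (real i + 1) + c):]) (\<lambda>_. 0))"

text \<open>
  With \<open>L\<^sub>0 = L(0)\<close>, the next three matrices are \<open>x\<^sup>-\<^sup>1 L\<^sub>0\<^sup>-\<^sup>1 \<Phi>\<^sup>* L\<^sub>0\<close>,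
  \<open>L\<^sub>0\<^sup>-\<^sup>1 \<Psi>\<^sup>* L\<^sub>0\<close> and \<open>L(x)\<^sup>-\<^sup>1 \<Psi>\<^sup>* L(x)\<close>. In closed form they are
  \<open>d J + c - d x A\<close>, \<open>x (d (J - (J + \<nu> + 1) A - N - 1) - c) + (J + \<nu> + 1) (d J + c) + B\<close> and
  \<open>(x A + J + \<nu> + 1 - x) (d J + c) + B\<close>; row \<open>i\<close> carries the entry \<open>i + 1\<close> of \<open>J\<close>.
\<close>

definition Phi_core :: "complex poly mat" where
  "Phi_core = scaled_mat N \<mu> (tri (\<lambda>_. [:0, of_real d:]) (\<lambda>i. [:of_real (d * (real i + 1) + c):]) (\<lambda>_. 0))"

definition Psi_core :: "complex poly mat" where
  "Psi_core = scaled_mat N \<mu> (tri (\<lambda>i. [:0, of_real (d * (\<nu> + 2 + real i)):])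
     (\<lambda>i. [:of_real ((\<nu> + 2 + real i) * (d * (real i + 1) + c)), of_real (d * (real i - real N) - c):])
     (\<lambda>i. [:of_real (- d * (real i + 1) * (real N - real i - 1)):]))"

definition Ztri :: "complex poly mat" where
  "Ztri = scaled_mat N \<mu> (tri (\<lambda>i. [:0, of_real (- (d * real i + c)):])
     (\<lambda>i. [:of_real ((\<nu> + 2 + real i) * (d * (real i + 1) + c)), of_real (- (d * (real i + 1) + c)):])
     (\<lambda>i. [:of_real (- d * (real i + 1) * (real N - real i - 1)):]))"

lemma core_carrier [simp]: "Phi_core \<in> carrier_mat N N" "Ediag \<in> carrier_mat N N"
    "Psi_core \<in> carrier_mat N N" "Ztri \<in> carrier_mat N N"
  by (simp_all add: Phi_core_def Ediag_def Psi_core_def Ztri_def)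

text \<open>The position of an entry relative to the diagonal. A product of a tridiagonal and a
  lower triangular matrix vanishes above the first superdiagonal, which is the last case.\<close>

lemma nat_diff_cases:
  fixes i j :: nat
  obtains k where "i = j + Suc k" | "i = j" | "j = Suc i" | "Suc i < j"
proof -
  consider "i > j" | "i = j" | "j = Suc i" | "Suc i < j" by linarith
  thus ?thesis by cases (use that less_imp_Suc_add[of j i] in auto)
qed

text \<open>Since \<open>[J, A] = A\<close>, conjugation by \<open>exp(x A)\<close> sends
  \<open>J\<close> to \<open>J - x A\<close>, hence \<open>d J + c\<close> to
  \<open>d J + c - d x A\<close>.\<close>

lemma Phi_core_Gmat: "Phi_core * Gmat N \<mu> = Gmat N \<mu> * Ediag"
  unfolding Phi_core_def Ediag_def Gmat_def scaled_mat_mult[OF \<mu>]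
proof (rule scaled_mat_cong)
  fix i j assume ij: "i < N" "j < N"
  show "(\<Sum>k = 0..<N. tri (\<lambda>_. [:0, of_real d:]) (\<lambda>i. [:of_real (d * (real i + 1)
    + c):]) (\<lambda>_. 0) i k * gfun k j) =
     (\<Sum>k = 0..<N. gfun i k * tri (\<lambda>_. 0) (\<lambda>i. [:of_real (d * (real i + 1) + c):]) (\<lambda>_. 0) k j)"
    unfolding sum_tri_left[OF ij(1)] sum_tri_right[OF ij(2)]
  proof (rule poly_eq_poly_eq_iff[THEN iffD1], rule ext)
    fix z
    show "poly ((if 0 < i then [:0, of_real d:] * gfun (i - 1) j else 0) +
             [:of_real (d * (real i + 1) + c):] * gfun i j + (if Suc i < N then 0 * gfun (Suc i) j else 0)) z =
          poly ((if Suc j < N then gfun i (Suc j) * 0 else 0) +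
             gfun i j * [:of_real (d * (real j + 1) + c):] + (if 0 < j then gfun i (j - 1) * 0 else 0)) z"
    proof (cases i j rule: nat_diff_cases)
      case (1 k)
      have "z * (of_real d * poly (gpow k) z) = of_real d * (- (of_nat k + 1) * poly (gpow (Suc k)) z)"
        unfolding poly_gpow_rec[symmetric] by (rule mult.left_commute)
      thus ?thesis using 1 ij by (simp add: gfun_def algebra_simps)
    qed (auto simp: gfun_def)
  qed
qed

text \<open>Here \<open>[A, B] = d (2 J - N - 1)\<close>, so conjugation by \<open>exp(x A)\<close>
  sends \<open>B\<close> to \<open>B + d x (2 J - N - 1) - d x^2 A\<close>, while
  \<open>x A + J\<close> goes to \<open>J\<close>. The product with \<open>d J + c\<close>
  contributes \<open>d x^2 A\<close>; the quadratic terms cancel and a matrix linear in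
  \<open>x\<close> remains. The proof verifies this entry by entry.\<close>

lemma Psi_core_Gmat: "Psi_core * Gmat N \<mu> = Gmat N \<mu> * Ztri"
  unfolding Psi_core_def Ztri_def Gmat_def scaled_mat_mult[OF \<mu>]
proof (rule scaled_mat_cong)
  fix i j assume ij: "i < N" "j < N"
  show "(\<Sum>k = 0..<N. tri (\<lambda>i. [:0, of_real (d * (\<nu> + 2 + real i)):])
     (\<lambda>i. [:of_real ((\<nu> + 2 + real i) * (d * (real i + 1) + c)), of_real (d * (real i - real N) - c):])
     (\<lambda>i. [:of_real (- d * (real i + 1) * (real N - real i - 1)):]) i k * gfun k j) =
     (\<Sum>k = 0..<N. gfun i k * tri (\<lambda>i. [:0, of_real (- (d * real i + c)):])
     (\<lambda>i. [:of_real ((\<nu> + 2 + real i) * (d * (real i + 1) + c)), of_real (- (d * (real i + 1) + c)):])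
     (\<lambda>i. [:of_real (- d * (real i + 1) * (real N - real i - 1)):]) k j)"
    unfolding sum_tri_left[OF ij(1)] sum_tri_right[OF ij(2)]
  proof (rule poly_eq_poly_eq_iff[THEN iffD1], rule ext)
    fix z
    show "poly ((if 0 < i then [:0, of_real (d * (\<nu> + 2 + real i)):] * gfun (i - 1) j else 0) +
             [:of_real ((\<nu> + 2 + real i) * (d * (real i + 1)
               + c)), of_real (d * (real i - real N) - c):] * gfun i j
             + (if Suc i < N then [:of_real (- d * (real i
               + 1) * (real N - real i - 1)):] * gfun (Suc i) j else 0)) z =
          poly ((if Suc j < N then gfun i (Suc j) * [:0, of_real (- (d * real (Suc j) + c)):] else 0) +
             gfun i j * [:of_real ((\<nu> + 2 + real j) * (d * (real j + 1) + c)), of_real (- (d * (real j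
               + 1) + c)):] +
             (if 0 < j then gfun i (j - 1) * [:of_real (- d * (real (j - 1)
               + 1) * (real N - real (j - 1) - 1)):] else 0)) z"
      (is "poly ?l z = poly ?r z")
    proof -
      \<comment> \<open>Complex names for the constants make both sides plain polynomial arithmetic;
        \<open>J\<close> is the column index here, not the matrix.\<close>
      define D C V n J where "D = complex_of_real d" and "C = complex_of_real c" and "V = complex_of_real \<nu>"
        and "n = (of_nat N :: complex)" and "J = (of_nat j :: complex)"
      note defs = D_def C_def V_def n_def J_def
      show ?thesis
      proof (cases i j rule: nat_diff_cases)
        case (1 k)
        define g h u K where "g = poly (gpow k) z" and "h = poly (gpow (Suc k)) z"
          and "u = poly (gpow (Suc (Suc k))) z" and "K = (of_nat k :: complex)"
        have rec: "z * g = - (K + 1) * h" "z * h = - (K + 2) * u"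
          using poly_gpow_rec[of z k] poly_gpow_rec[of z "Suc k"] by (simp_all add: g_def h_def u_def K_def)
        have l: "poly ?l z = D * (V + 2 + (J + K + 1)) * (z * g)
            + (V + 2 + (J + K + 1)) * (D * (J + K + 2) + C) * h + (D * (J + K + 1 - n) - C) * (z * h)
            + (- D * (J + K + 2) * (n - (J + K + 2))) * u"
        \<comment> \<open>In the last row the superdiagonal term is absent, but its coefficient
          contains \<open>n - (J + K + 2)\<close>, which is then zero; so one formula covers all
          rows.\<close>
        proof (cases "Suc i < N")
          case False
          hence "N = j + k + 2" using ij 1 by simp
          hence "n = J + K + 2" by (simp add: defs K_def)
          thus ?thesis using False ij 1 by (simp add: gfun_def defs K_def g_def h_def u_def algebra_simps)
        qed (use 1 in \<open>simp add: gfun_def defs K_def g_def h_def u_def algebra_simps Suc_diff_le\<close>)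
        \<comment> \<open>Likewise the term absent for \<open>j = 0\<close> carries the factor
          \<open>J\<close>.\<close>
        have r: "poly ?r z = - (D * (J + 1) + C) * (z * g)
            + (V + 2 + J) * (D * (J + 1) + C) * h - (D * (J + 1) + C) * (z * h) - D * J * (n - J) * u"
          using 1 ij by (cases j) (simp_all add: gfun_def defs K_def g_def h_def u_def algebra_simps
            Suc_diff_le)
        show ?thesis unfolding l r rec by (simp add: algebra_simps)
      next
        case 2
        show ?thesis
        proof (cases "Suc i < N")
          case True
          thus ?thesis using 2 by (cases j) (auto simp: gfun_def poly_gpow algebra_simps)
        next
          case False
          hence "N = Suc j" using 2 ij by simp
          thus ?thesis using 2 by (cases j) (auto simp: gfun_def poly_gpow algebra_simps)
        qed
      next
        case 3
        thus ?thesis using ij by (auto simp: gfun_def algebra_simps)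
      next
        case 4
        thus ?thesis using ij by (auto simp: gfun_def)
      qed
    qed
  qed
qed

lemma Ediag_Dpoly: "Ediag * Dpoly N \<delta> \<nu> = Dpoly N \<delta> (\<nu> + 1)"
proof (rule eq_matI)
  fix i j assume "i < dim_row (Dpoly N \<delta> (\<nu> + 1))" "j < dim_col (Dpoly N \<delta> (\<nu> + 1))"
  hence ij: "i < N" "j < N" by simp_all
  show "(Ediag * Dpoly N \<delta> \<nu>) $$ (i, j) = Dpoly N \<delta> (\<nu> + 1) $$ (i, j)"
    unfolding mult_Dpoly_index[OF core_carrier(2) ij]
    using ij \<mu> \<delta>_Suc[of "Suc i"]
    by (auto simp: Ediag_def scaled_mat_def tri_def Dpoly_def mat_diag_def smult_monom add.commute)
qed (simp_all add: Ediag_def scaled_mat_def)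

text \<open>The derivative of the weight for \<open>\<nu> + 1\<close>, with the scalar factor and
  both outer factors \<open>L\<close> removed: \<open>A\<close> and its adjoint arise from
  differentiating those factors. The diagonal and subdiagonal follow from
  \<open>\<delta>_Suc\<close>, and the superdiagonal is exactly \<open>\<mu>_ratio\<close>.\<close>

lemma Ztri_Dpoly:
  "Ztri * Dpoly N \<delta> \<nu> =
     [:0, 1:] \<cdot>\<^sub>m (pconst (Amat N \<mu>) * Dpoly N \<delta> (\<nu> + 1) + matpoly_deriv (Dpoly N \<delta> (\<nu> + 1))
       + Dpoly N \<delta> (\<nu> + 1) * padj (pconst (Amat N \<mu>)))
     + [:of_real (\<nu> + 1), - 1:] \<cdot>\<^sub>m Dpoly N \<delta> (\<nu> + 1)"
  (is "_ = ?r")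
proof (rule eq_matI)
  fix i j assume "i < dim_row ?r" "j < dim_col ?r"
  hence ij: "i < N" "j < N" by simp_all
  have A: "pconst (Amat N \<mu>) \<in> carrier_mat N N" "padj (pconst (Amat N \<mu>)) \<in> carrier_mat N N"
    by (simp_all add: Amat_def)
  have r: "?r $$ (i, j) = [:0, 1:] * (pconst (Amat N \<mu>) $$ (i, j) * monom (of_real (\<delta> (\<nu> + 1) (Suc j))) (Suc j)
        + pderiv (Dpoly N \<delta> (\<nu> + 1) $$ (i, j))
        + monom (of_real (\<delta> (\<nu> + 1) (Suc i))) (Suc i) * padj (pconst (Amat N \<mu>)) $$ (i, j))
      + [:of_real (\<nu> + 1), - 1:] * Dpoly N \<delta> (\<nu> + 1) $$ (i, j)"
    using ij A mult_Dpoly_index[OF A(1) ij, of \<delta> "\<nu> + 1"] Dpoly_mult_index[OF A(2) ij, of \<delta> "\<nu> + 1"]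
    by (simp add: matpoly_deriv_def)
  show "(Ztri * Dpoly N \<delta> \<nu>) $$ (i, j) = ?r $$ (i, j)"
    unfolding mult_Dpoly_index[OF core_carrier(4) ij] r
  proof (rule poly_eq_poly_eq_iff[THEN iffD1], rule ext)
    fix z
    show "poly (Ztri $$ (i, j) * monom (of_real (\<delta> \<nu> (Suc j))) (Suc j)) z =
       poly ([:0, 1:] * (pconst (Amat N \<mu>) $$ (i, j) * monom (of_real (\<delta> (\<nu> + 1) (Suc j))) (Suc j)
        + pderiv (Dpoly N \<delta> (\<nu> + 1) $$ (i, j))
        + monom (of_real (\<delta> (\<nu> + 1) (Suc i))) (Suc i) * padj (pconst (Amat N \<mu>)) $$ (i, j))
      + [:of_real (\<nu> + 1), - 1:] * Dpoly N \<delta> (\<nu> + 1) $$ (i, j)) z"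
    proof -
      consider "i = Suc j" | "i = j" | "j = Suc i" | "i \<noteq> Suc j" "i \<noteq> j" "j \<noteq> Suc i" by auto
      thus ?thesis
      proof cases
        case 1
        thus ?thesis using ij \<delta>_Suc[of "Suc j"]
          by (simp add: Ztri_def scaled_mat_def tri_def Dpoly_def mat_diag_def pconst_def padj_def
            Amat_def poly_monom
              algebra_simps add_divide_distrib)
      next
        case 2
        thus ?thesis using ij \<delta>_Suc[of "Suc j"] \<mu>
          by (simp add: Ztri_def scaled_mat_def tri_def Dpoly_def mat_diag_def pconst_def padj_def
            Amat_def poly_monom
              pderiv_monom algebra_simps)
      next
        case 3
        have nz: "\<mu> (Suc i) \<noteq> 0" "\<mu> (Suc j) \<noteq> 0" "\<delta> (\<nu> + 1) (Suc i) \<noteq> 0"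
          using ij \<mu> \<delta>_pos(2)[of "Suc i"] by auto
        have "(\<mu> (Suc j))\<^sup>2 / (\<mu> (Suc i))\<^sup>2 =
            d * real (Suc i) * (real N - real (Suc i)) * (\<delta> \<nu> (Suc j) / \<delta> (\<nu> + 1) (Suc i))"
          using \<mu>_ratio[of "Suc i"] ij 3 by simp
        hence "\<mu> (Suc i) / \<mu> (Suc j) * (d * (real i + 1) * (real N - real i - 1)) * \<delta> \<nu> (Suc j) =
            \<delta> (\<nu> + 1) (Suc i) * (\<mu> (Suc j) / \<mu> (Suc i))"
          using nz by (simp add: field_simps power2_eq_square)
        hence *: "complex_of_real (\<mu> (Suc i) / \<mu> (Suc j)) * of_real (- d * (real i
          + 1) * (real N - real i - 1)) * of_real (\<delta> \<nu> (Suc j)) =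
            - of_real (\<delta> (\<nu> + 1) (Suc i)) * of_real (\<mu> (Suc j) / \<mu> (Suc i))"
          unfolding of_real_mult[symmetric] of_real_minus[symmetric] of_real_eq_iff by (simp add: algebra_simps)
        have "poly (Ztri $$ (i, j) * monom (of_real (\<delta> \<nu> (Suc j))) (Suc j)) z =
            complex_of_real (\<mu> (Suc i) / \<mu> (Suc j)) * of_real (- d * (real i
              + 1) * (real N - real i - 1)) * of_real (\<delta> \<nu> (Suc j)) * z ^ Suc j"
          using 3 ij by (simp add: Ztri_def scaled_mat_def tri_def poly_monom mult_ac)
        thus ?thesis unfolding * using 3 ij
          by (simp add: Dpoly_def mat_diag_def pconst_def padj_def Amat_def poly_monom map_poly_pCons)
      next
        case 4
        thus ?thesis using ij
          by (simp add: Ztri_def scaled_mat_def tri_def Dpoly_def mat_diag_def pconst_def padj_def Amat_def)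
      qed
    qed
  qed
qed (simp_all add: Ztri_def scaled_mat_def pconst_def Amat_def matpoly_deriv_def)

abbreviation L0 :: "complex poly mat" where "L0 \<equiv> pconst (Lmat N \<mu> \<alpha> 0)"

abbreviation L0i :: "complex poly mat" where "L0i \<equiv> pconst (minv (Lmat N \<mu> \<alpha> 0))"

text \<open>The polynomial forms of the adjoints of \<open>\<Phi>\<close> and \<open>\<Psi>\<close>;
  agreement on the positive reals is shown in \<open>mat_adjoint_Phi\<close> and
  \<open>mat_adjoint_Psi\<close>.\<close>

definition Phi_poly :: "complex poly mat" where
  "Phi_poly = [:0, 1:] \<cdot>\<^sub>m (L0 * Phi_core * L0i)"

definition Psi_poly :: "complex poly mat" where
  "Psi_poly = L0 * Psi_core * L0i"

lemmas minv_Lmat = minv[OF Lmat_carrier, of N \<mu> \<alpha> 0, unfolded det_Lmat[OF \<mu>], OF one_neq_zero[where 'a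
  = complex]]

declare minv_Lmat(3) [simp]

lemma L0_inverse: "L0i * L0 = 1\<^sub>m N"
  using minv_Lmat by (simp add: pconst_one flip: pconst_mult[of _ N N _ N])

lemmas sq_simps = mult_carrier_mat[of _ N N _ N] assoc_mult_mat[of _ N N _ N _ N]
  mult_smult_distrib[of _ N N _ N] mult_smult_assoc_mat[of _ N N _ N]

lemma Phi_Psi_poly_carrier [simp]: "Phi_poly \<in> carrier_mat N N" "Psi_poly \<in> carrier_mat N N"
  by (simp_all add: Phi_poly_def Psi_poly_def sq_simps)

lemma Phi_Psi_mult:
  assumes Y: "Y \<in> carrier_mat N N"
  shows "Phi_poly * (Lpoly N \<mu> \<alpha> * (Dpoly N \<delta> \<nu> * Y)) = [:0, 1:] \<cdot>\<^sub>m (Lpoly N \<mu> \<alpha> * (Dpoly N \<delta> (\<nu> + 1) * Y))"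
    and "Psi_poly * (Lpoly N \<mu> \<alpha> * (Dpoly N \<delta> \<nu> * Y)) = Lpoly N \<mu> \<alpha> * (Ztri * Dpoly N \<delta> \<nu> * Y)"
proof -
  \<comment> \<open>Products are normalised to the right, so each commutation rule is restated with
    a trailing factor \<open>U\<close>.\<close>
  have c: "L0i * (L0 * U) = U" "Phi_core * (Gmat N \<mu> * U) = Gmat N \<mu> * (Ediag * U)"
    "Psi_core * (Gmat N \<mu> * U) = Gmat N \<mu> * (Ztri * U)"
    "Ediag * (Dpoly N \<delta> \<nu> * U) = Dpoly N \<delta> (\<nu> + 1) * U" if U: "U \<in> carrier_mat N N" for U
    using U by (simp_all add: L0_inverse Phi_core_Gmat Psi_core_Gmat Ediag_Dpoly left_mult_one_mat[of _ N N]
        flip: assoc_mult_mat[of _ N N _ N _ N])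
  show "Phi_poly * (Lpoly N \<mu> \<alpha> * (Dpoly N \<delta> \<nu> * Y)) = [:0, 1:] \<cdot>\<^sub>m (Lpoly N \<mu> \<alpha> * (Dpoly N \<delta> (\<nu> + 1) * Y))"
    "Psi_poly * (Lpoly N \<mu> \<alpha> * (Dpoly N \<delta> \<nu> * Y)) = Lpoly N \<mu> \<alpha> * (Ztri * Dpoly N \<delta> \<nu> * Y)"
    using Y by (simp_all add: Phi_poly_def Psi_poly_def Lpoly_def sq_simps c)
qed

text \<open>The relation between the two weights divided by \<open>exp (- x) * x powr \<nu>\<close>;
  the surplus power of \<open>x\<close> in the weight for \<open>\<nu> + 1\<close> remains.\<close>

lemma Phi_poly_Mpoly: "Phi_poly * Mpoly N \<mu> \<delta> \<alpha> \<nu> = [:0, 1:] \<cdot>\<^sub>m Mpoly N \<mu> \<delta> \<alpha> (\<nu> + 1)"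
  using Phi_Psi_mult(1)[of "padj (Lpoly N \<mu> \<alpha>)"] by (simp add: Mpoly_def sq_simps)

text \<open>The right-hand side is the derivative of \<open>exp (- x) * x powr (\<nu> + 1)\<close>
  times the matrix polynomial, divided by \<open>exp (- x) * x powr \<nu>\<close>. It is
  \<open>Ztri_Dpoly\<close> with the factors \<open>L\<close> restored.\<close>

lemma Psi_poly_Mpoly:
  "Psi_poly * Mpoly N \<mu> \<delta> \<alpha> \<nu> =
     [:0, 1:] \<cdot>\<^sub>m matpoly_deriv (Mpoly N \<mu> \<delta> \<alpha> (\<nu> + 1))
     + [:of_real (\<nu> + 1), - 1:] \<cdot>\<^sub>m Mpoly N \<mu> \<delta> \<alpha> (\<nu> + 1)"
proof -
  have A: "pconst (Amat N \<mu>) \<in> carrier_mat N N" "padj (pconst (Amat N \<mu>)) \<in> carrier_mat N N"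
    by (simp_all add: Amat_def)
  show ?thesis
    using A Phi_Psi_mult(2)[of "padj (Lpoly N \<mu> \<alpha>)"]
    by (simp add: Mpoly_def sq_simps Ztri_Dpoly matpoly_deriv_mult[of _ N N _ N] matpoly_deriv_padj
        matpoly_deriv_Lpoly[OF \<mu>] padj_mult[of _ N N _ N] add_mult_distrib_mat[of _ N N _ _ N]
        mult_add_distrib_mat[of _ N N _ N] add_carrier_mat[of _ N N] assoc_add_mat[of _ N N])
qed

section \<open>The functions \<open>\<Phi>\<close> and \<open>\<Psi>\<close> as matrix
  polynomials\<close>

lemma mat_deriv_Wmat:
  assumes x: "x > 0"
  shows "mat_deriv N (Wmat N \<mu> \<delta> \<alpha> (\<nu> + 1)) x = complex_of_real (exp (- x) * x powr \<nu>) \<cdot>\<^sub>m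
    matpoly_eval ([:0, 1:] \<cdot>\<^sub>m matpoly_deriv (Mpoly N \<mu> \<delta> \<alpha> (\<nu> + 1))
      + [:of_real (\<nu> + 1), - 1:] \<cdot>\<^sub>m Mpoly N \<mu> \<delta> \<alpha> (\<nu> + 1)) x"
    (is "_ = ?r")
proof (rule eq_matI)
  have carr: "Mpoly N \<mu> \<delta> \<alpha> (\<nu> + 1) \<in> carrier_mat N N" by simp
  note dims = carrier_matD[OF carr]
  show "dim_row (mat_deriv N (Wmat N \<mu> \<delta> \<alpha> (\<nu> + 1)) x) = dim_row ?r"
    "dim_col (mat_deriv N (Wmat N \<mu> \<delta> \<alpha> (\<nu> + 1)) x) = dim_col ?r"
    using dims by (simp_all add: mat_deriv_def matpoly_eval_def)
  fix i j assume "i < dim_row ?r" "j < dim_col ?r"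
  hence ij: "i < N" "j < N" using dims by (simp_all add: matpoly_eval_def)
  define p where "p = Mpoly N \<mu> \<delta> \<alpha> (\<nu> + 1) $$ (i, j)"
  have "((\<lambda>t. complex_of_real (exp (- t) * t powr (\<nu> + 1)) * poly p (complex_of_real t)) has_vector_derivative
     complex_of_real (exp (- x) * x powr \<nu>) * (of_real x * poly (pderiv p) (of_real x) + (of_real (\<nu>
       + 1) - of_real x) * poly p (of_real x))) (at x)"
  proof -
    have "((\<lambda>t. exp (- t) * t powr (\<nu> + 1)) has_real_derivative
        exp (- x) * x powr \<nu> * ((\<nu> + 1) - x)) (at x)"
    proof -
      have "((\<lambda>t. exp (- t)) has_real_derivative - exp (- x)) (at x)"
        by (auto intro!: derivative_eq_intros)
      from DERIV_mult[OF this has_real_derivative_powr[OF x, of "\<nu> + 1"]] x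
      show ?thesis by (simp add: powr_add algebra_simps)
    qed
    hence 1: "((\<lambda>t. complex_of_real (exp (- t) * t powr (\<nu> + 1))) has_vector_derivative
        complex_of_real (exp (- x) * x powr \<nu> * ((\<nu> + 1) - x))) (at x)"
      by (intro has_vector_derivative_of_real) (simp add: has_real_derivative_iff_has_vector_derivative)
    have 2: "((\<lambda>t. poly p (complex_of_real t)) has_vector_derivative poly (pderiv p) (of_real x)) (at x)"
      using has_vector_derivative_real_field[OF poly_DERIV[of p "of_real x"]] by (simp add: o_def)
    show ?thesis
      using has_vector_derivative_mult[OF 1 2] x by (simp add: powr_add algebra_simps)
  qed
  hence "((\<lambda>t. Wmat N \<mu> \<delta> \<alpha> (\<nu> + 1) t $$ (i, j)) has_vector_derivative
     complex_of_real (exp (- x) * x powr \<nu>) * (of_real x * poly (pderiv p) (of_real x) + (of_real (\<nu>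
       + 1) - of_real x) * poly p (of_real x))) (at x)"
    \<comment> \<open>The polynomial form of the weight is known only for positive arguments, an
      open set around \<open>x\<close>.\<close>
    by (rule has_vector_derivative_transform_within_open[of _ _ _ "{0<..}"])
       (use x ij dims in \<open>auto simp: Wmat_eq[OF \<mu>] matpoly_eval_def p_def\<close>)
  thus "mat_deriv N (Wmat N \<mu> \<delta> \<alpha> (\<nu> + 1)) x $$ (i, j) = ?r $$ (i, j)"
    using ij dims
    by (simp add: mat_deriv_def matpoly_eval_def matpoly_deriv_def p_def vector_derivative_at algebra_simps)
qed

lemma Wmat_carrier [simp]: "Wmat N \<mu> \<delta> \<alpha> s x \<in> carrier_mat N N"
  by (simp add: Wmat_def Tmat_def mult_carrier_mat[of _ N N _ N])

lemma det_Wmat: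
  assumes "x > 0"
  shows "det (Wmat N \<mu> \<delta> \<alpha> \<nu> x) \<noteq> 0"
proof -
  have T: "Tmat N \<delta> \<nu> x \<in> carrier_mat N N" by (simp add: Tmat_def)
  have "det (Tmat N \<delta> \<nu> x) = prod_list (diag_mat (Tmat N \<delta> \<nu> x))"
    by (rule det_lower_triangular[OF _ T]) (simp add: Tmat_def)
  also have "\<dots> \<noteq> 0"
  proof -
    have "\<delta> \<nu> (Suc i) \<noteq> 0" if "i < N" for i using \<delta>_pos(1)[of "Suc i"] that by simp
    thus ?thesis using assms by (auto simp: prod_list_zero_iff diag_mat_def Tmat_def)
  qed
  finally have dT: "det (Tmat N \<delta> \<nu> x) \<noteq> 0" .
  have "upper_triangular (mat_adjoint (Lmat N \<mu> \<alpha> x))"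
    by (auto simp: Lmat_def)
  hence "det (mat_adjoint (Lmat N \<mu> \<alpha> x)) = prod_list (diag_mat (mat_adjoint (Lmat N \<mu> \<alpha> x)))"
    by (rule det_upper_triangular[of _ N]) simp
  also have "diag_mat (mat_adjoint (Lmat N \<mu> \<alpha> x)) = map (\<lambda>_. 1) [0..<N]"
    using \<mu> by (auto simp: diag_mat_def Lmat_def)
  finally show ?thesis
    using dT T by (simp add: Wmat_def det_mult[of _ N] mult_carrier_mat[of _ N N _ N] det_Lmat[OF \<mu>]
      map_replicate_const)
qed

text \<open>As \<open>S = P M\<close> is self-adjoint, it also equals \<open>M\<close> times the
  adjoint of \<open>P\<close>, and the inverse weight cancels \<open>M\<close> together with the
  scalar factor. \<open>\<Phi>\<close> and \<open>\<Psi>\<close> are both instances.\<close>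

lemma mat_adjoint_minv_Wmat:
  assumes x: "x > 0" and P: "P \<in> carrier_mat N N" and S: "P * Mpoly N \<mu> \<delta> \<alpha> \<nu> = S" "padj S = S"
  shows "mat_adjoint (minv (Wmat N \<mu> \<delta> \<alpha> \<nu> x) * (complex_of_real (exp (- x) * x powr \<nu>) \<cdot>\<^sub>m matpoly_eval S x))
    = matpoly_eval P x"
proof -
  let ?W = "Wmat N \<mu> \<delta> \<alpha> \<nu> x" and ?w = "complex_of_real (exp (- x) * x powr \<nu>)"
  note W = minv[OF Wmat_carrier det_Wmat[OF x]]
  have "padj S = Mpoly N \<mu> \<delta> \<alpha> \<nu> * padj P"
    using P by (simp add: padj_mult[of _ N N _ N] padj_Mpoly flip: S(1))
  hence "?w \<cdot>\<^sub>m matpoly_eval S x = ?W * mat_adjoint (matpoly_eval P x)"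
    unfolding S(2) using P
    by (simp add: Wmat_eq[OF \<mu> x] matpoly_eval_mult[of _ N N _ N] matpoly_eval_padj sq_simps)
  hence "minv ?W * (?w \<cdot>\<^sub>m matpoly_eval S x) = minv ?W * ?W * mat_adjoint (matpoly_eval P x)"
    using assoc_mult_mat[OF W(3) Wmat_carrier, of "mat_adjoint (matpoly_eval P x)" N] P by simp
  thus ?thesis using W P by (simp add: left_mult_one_mat[of _ N N])
qed

lemma mat_adjoint_Phi:
  assumes x: "x > 0"
  shows "mat_adjoint (Phi N \<mu> \<delta> \<alpha> \<nu> x) = matpoly_eval Phi_poly x"
proof -
  have "Wmat N \<mu> \<delta> \<alpha> (\<nu> + 1) x = complex_of_real (exp (- x) * x powr \<nu>) \<cdot>\<^sub>m
      matpoly_eval ([:0, 1:] \<cdot>\<^sub>m Mpoly N \<mu> \<delta> \<alpha> (\<nu> + 1)) x"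
    using x unfolding Wmat_eq[OF \<mu> x] matpoly_eval_smult
    by (intro eq_matI) (simp_all add: powr_add mult_ac)
  thus ?thesis
    unfolding Phi_def
    using mat_adjoint_minv_Wmat[OF x _ Phi_poly_Mpoly] by (simp add: padj_smult padj_Mpoly map_poly_pCons)
qed

lemma mat_adjoint_Psi:
  assumes x: "x > 0"
  shows "mat_adjoint (Psi N \<mu> \<delta> \<alpha> \<nu> x) = matpoly_eval Psi_poly x"
  unfolding Psi_def mat_deriv_Wmat[OF x]
  by (rule mat_adjoint_minv_Wmat[OF x _ Psi_poly_Mpoly])
     (simp_all add: padj_smult padj_Mpoly padj_add[of _ N N] map_poly_pCons flip: matpoly_deriv_padj)

end


section \<open>The matrix valued inner product\<close>

text \<open>The pairing of polynomials in formal terms: \<open>s\<close> is the exponent of the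
  scalar weight and \<open>M\<close> the polynomial part. \<open>pairing_Wmat\<close> relates it to
  the integral.\<close>

definition mat_ip :: "real \<Rightarrow> complex poly mat \<Rightarrow> complex poly mat \<Rightarrow> complex poly mat \<Rightarrow> complex mat" where
  "mat_ip s M P Q = map_mat (lagint s) (P * M * padj Q)"

lemma mat_ip_carrier [simp]:
  "P \<in> carrier_mat N N \<Longrightarrow> Q \<in> carrier_mat N N \<Longrightarrow> mat_ip s M P Q \<in> carrier_mat N N"
  by (auto simp: mat_ip_def)

lemma map_mat_lagint_diff:
  assumes "s > - 1" "A \<in> carrier_mat n m" "B \<in> carrier_mat n m"
  shows "map_mat (lagint s) (A - B) = map_mat (lagint s) A - map_mat (lagint s) B"
  using assms by (intro eq_matI) (auto simp: lagint_diff)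

lemma map_mat_lagint_pconst_mult:
  assumes "s > - 1" "C \<in> carrier_mat n m" "A \<in> carrier_mat m k"
  shows "map_mat (lagint s) (pconst C * A) = C * map_mat (lagint s) A"
  using assms unfolding pconst_def
  by (intro eq_matI) (auto simp: scalar_prod_def lagint_sum lagint_mult_const(1) simp del: mult_pCons_left)

lemma map_mat_lagint_mult_pconst:
  assumes "s > - 1" "A \<in> carrier_mat n m" "C \<in> carrier_mat m k"
  shows "map_mat (lagint s) (A * pconst C) = map_mat (lagint s) A * C"
  using assms unfolding pconst_def
  by (intro eq_matI) (auto simp: scalar_prod_def lagint_sum lagint_mult_const(2) simp del: mult_pCons_right)

lemmas square_mat_simps = mult_carrier_mat[where nr = N and n = N and nc = N]
  assoc_mult_mat[where n\<^sub>1 = N and n\<^sub>2 = N and n\<^sub>3 = N and n\<^sub>4 = N] for N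

text \<open>A strict bound, so that \<open>n = 0\<close> describes the zero polynomial and can start
  an induction.\<close>

definition deg_less :: "nat \<Rightarrow> nat \<Rightarrow> complex poly mat \<Rightarrow> bool" where
  "deg_less N n P \<longleftrightarrow> P \<in> carrier_mat N N \<and> (\<forall>k\<ge>n. matpoly_coeff P k = 0\<^sub>m N N)"

lemma deg_less_0: "deg_less N 0 P \<longleftrightarrow> P = 0\<^sub>m N N"
proof
  assume *: "deg_less N 0 P"
  have "matpoly_coeff (0\<^sub>m N N) k = 0\<^sub>m N N" for k
    by (intro eq_matI) (auto simp: matpoly_coeff_def)
  with * show "P = 0\<^sub>m N N"
    by (subst matpoly_eq_iff_coeff[of _ N N]) (auto simp: deg_less_def)
qed (auto simp: deg_less_def matpoly_coeff_def)

context
  fixes N :: nat and s :: real and M :: "complex poly mat"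
  assumes s: "s > - 1" and M: "M \<in> carrier_mat N N"
begin

lemma mat_ip_diff_left:
  assumes "P \<in> carrier_mat N N" "P' \<in> carrier_mat N N" "Q \<in> carrier_mat N N"
  shows "mat_ip s M (P - P') Q = mat_ip s M P Q - mat_ip s M P' Q"
  using s M assms
  by (simp add: mat_ip_def minus_mult_distrib_mat[of _ N N _ _ N] square_mat_simps[where N
    = N] map_mat_lagint_diff[of _ _ N N])

lemma mat_ip_diff_right:
  assumes "P \<in> carrier_mat N N" "Q' \<in> carrier_mat N N" "Q \<in> carrier_mat N N"
  shows "mat_ip s M P (Q - Q') = mat_ip s M P Q - mat_ip s M P Q'"
  using s M assms
  by (simp add: mat_ip_def mult_minus_distrib_mat[of _ N N _ N] square_mat_simps[where N
    = N] map_mat_lagint_diff[of _ _ N N] padj_diff[of _ N N])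

lemma mat_ip_pconst_left:
  assumes "P \<in> carrier_mat N N" "C \<in> carrier_mat N N" "Q \<in> carrier_mat N N"
  shows "mat_ip s M (pconst C * P) Q = C * mat_ip s M P Q"
  using s M assms by (simp add: mat_ip_def square_mat_simps[where N
    = N] map_mat_lagint_pconst_mult[of _ _ N N _ N])

lemma mat_ip_pconst_right:
  assumes "P \<in> carrier_mat N N" "C \<in> carrier_mat N N" "Q \<in> carrier_mat N N"
  shows "mat_ip s M P (pconst C * Q) = mat_ip s M P Q * mat_adjoint C"
proof -
  have *: "P * M * padj (pconst C * Q) = (P * M * padj Q) * pconst (mat_adjoint C)"
    using M assms by (simp add: square_mat_simps[where N = N] padj_mult[of _ N N _ N] padj_pconst)
  show ?thesis unfolding mat_ip_def *
    using M assms by (intro map_mat_lagint_mult_pconst[OF s, of _ N N _ N])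
      (simp_all add: square_mat_simps[where N = N])
qed

text \<open>Polynomials of degree below \<open>m\<close> are left combinations of the first
  \<open>m\<close> monic ones: subtracting \<open>C * P m\<close>, with \<open>C\<close> the
  coefficient of \<open>x^m\<close>, lowers the bound in the induction. \<open>ladder_down\<close>
  uses the first order of the arguments, \<open>ladder_up\<close> the second.\<close>

lemma orthogonal_deg_less:
  assumes mono: "\<And>n. monic_of_degree N n (P n)"
    and orth: "\<And>n m. n \<noteq> m \<Longrightarrow> mat_ip s M (P n) (P m) = 0\<^sub>m N N"
    and "deg_less N m R" "m \<le> n"
  shows "mat_ip s M (P n) R = 0\<^sub>m N N \<and> mat_ip s M R (P n) = 0\<^sub>m N N"
  using assms(3,4)
proof (induction m arbitrary: R)
  have P: "P k \<in> carrier_mat N N" for k using mono[of k] by (simp add: monic_of_degree_def)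
  case 0
  have "padj (0\<^sub>m N N) = 0\<^sub>m N N" by (intro eq_matI) (auto simp: padj_def)
  moreover have "map_mat (lagint s) (0\<^sub>m N N) = 0\<^sub>m N N" by (intro eq_matI) auto
  ultimately show ?case using 0 P[of n] M
    by (simp add: deg_less_0 mat_ip_def square_mat_simps[where N
      = N] right_mult_zero_mat[of _ N N] left_mult_zero_mat[of _ N N])
next
  case (Suc m)
  have P: "P k \<in> carrier_mat N N" for k using mono[of k] by (simp add: monic_of_degree_def)
  have R: "R \<in> carrier_mat N N" using Suc.prems by (simp add: deg_less_def)
  define C where "C = matpoly_coeff R m"
  have C: "C \<in> carrier_mat N N" using R by (simp add: C_def)
  have PC: "pconst C * P m \<in> carrier_mat N N" using P C by (simp add: square_mat_simps[where N = N])
  have "deg_less N m (R - pconst C * P m)"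
    unfolding deg_less_def
  proof (intro conjI allI impI)
    fix k assume "k \<ge> m"
    show "matpoly_coeff (R - pconst C * P m) k = 0\<^sub>m N N"
    proof (cases "k = m")
      case True
      thus ?thesis using R P C PC mono[of m]
        by (simp add: matpoly_coeff_diff[of _ N N] matpoly_coeff_pconst_mult[of _ N N _ N]
             monic_of_degree_def C_def[symmetric] minus_r_inv_mat[of _ N N] right_mult_one_mat[of _ N N])
    next
      case False
      hence "k > m" using \<open>k \<ge> m\<close> by simp
      thus ?thesis using R P C PC mono[of m] Suc.prems
        by (simp add: matpoly_coeff_diff[of _ N N] matpoly_coeff_pconst_mult[of _ N N _ N]
             monic_of_degree_def deg_less_def right_mult_zero_mat[of _ N N])
    qed
  qed (use R minus_carrier_mat[OF PC] in auto)
  from Suc.IH[OF this] Suc.prems(2)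
  have 1: "mat_ip s M (P n) (R - pconst C * P m) = 0\<^sub>m N N" "mat_ip s M (R - pconst C * P m) (P n) = 0\<^sub>m N N"
    by simp_all
  have 2: "mat_ip s M (P n) (pconst C * P m) = 0\<^sub>m N N" "mat_ip s M (pconst C * P m) (P n) = 0\<^sub>m N N"
    using Suc.prems(2) P C orth[of n m] orth[of m n]
    by (simp_all add: mat_ip_pconst_right mat_ip_pconst_left left_mult_zero_mat[of _ N N]
      right_mult_zero_mat[of _ N N])
  have 3: "A - 0\<^sub>m N N = A" if "A \<in> carrier_mat N N" for A :: "complex mat"
    using that by (intro eq_matI) auto
  show ?case
    using 1 R P[of n] mat_ip_carrier[OF P[of n] R, of s M] mat_ip_carrier[OF R P[of n], of s M]
    by (simp add: mat_ip_diff_left[OF R PC P] mat_ip_diff_right[OF P PC R] 2 3)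
qed

end

text \<open>With \<open>T = R L\<close>, the \<open>i\<close>-th diagonal entry is the integral of a
  sum of squares \<open>|T\<^sub>i\<^sub>k|^2\<close> with positive weights. Hence
  \<open>T = 0\<close>, and \<open>L(x)\<close> has determinant one, so it cancels at every
  point.\<close>

lemma mat_ip_pos_def:
  assumes \<mu>: "\<forall>k\<in>{1..N}. \<mu> k \<noteq> 0" and s: "s > - 1"
    and \<delta>: "\<And>k. k \<in> {1..N} \<Longrightarrow> \<delta> s k > 0"
    and R: "R \<in> carrier_mat N N" and z: "mat_ip s (Mpoly N \<mu> \<delta> \<alpha> s) R R = 0\<^sub>m N N"
  shows "R = 0\<^sub>m N N"
proof -
  define T where "T = R * Lpoly N \<mu> \<alpha>"
  have T: "T \<in> carrier_mat N N" using R by (simp add: T_def mult_carrier_mat[of _ N N _ N])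
  have F: "R * Mpoly N \<mu> \<delta> \<alpha> s * padj R = T * Dpoly N \<delta> s * padj T"
    using R by (simp add: T_def Mpoly_def square_mat_simps[where N = N] padj_mult[of _ N N _ N])
  have Fii: "poly ((T * Dpoly N \<delta> s * padj T) $$ (i, i)) (of_real x) =
      of_real (\<Sum>k\<in>{0..<N}. \<delta> s (Suc k) * x ^ Suc k * (cmod (poly (T $$ (i, k)) (of_real x)))\<^sup>2)"
    if i: "i < N" for i x
  proof -
    have "(T * Dpoly N \<delta> s * padj T) $$ (i, i) = (\<Sum>k\<in>{0..<N}. (T * Dpoly N \<delta> s) $$ (i, k) * padj T $$ (k, i))"
      using i T by (auto simp: scalar_prod_def)
    also have "\<dots> = (\<Sum>k\<in>{0..<N}. T $$ (i, k) * monom (of_real (\<delta> s (Suc k))) (Suc k) * map_poly cnj (T $$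
      (i, k)))"
      using i T by (intro sum.cong refl) (simp add: mult_Dpoly_index padj_def del: index_mult_mat(1))
    finally show ?thesis
      using complex_norm_square[symmetric] by (simp add: poly_sum poly_monom poly_map_poly_cnj mult_ac)
  qed
  have "T $$ (i, k) = 0" if ik: "i < N" "k < N" for i k
  proof (rule poly_eqI_pos_real)
    fix x :: real assume x: "x > 0"
    have nn: "\<delta> s (Suc k) * y ^ Suc k * (cmod (poly (T $$ (i, k)) (of_real y)))\<^sup>2 \<ge> 0" if "k < N"
      "y > 0" for k y
      using \<delta>[of "Suc k"] that by (intro mult_nonneg_nonneg) auto
    have "lagint s ((T * Dpoly N \<delta> s * padj T) $$ (i, i)) = 0"
      using arg_cong[OF z, of "\<lambda>A. A $$ (i, i)"] ik R T unfolding mat_ip_def F by simp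
    hence "(T * Dpoly N \<delta> s * padj T) $$ (i, i) = 0"
    proof (rule lagint_pos_def[OF s, rotated])
      fix y :: real assume y: "y > 0"
      show "\<exists>r\<ge>0. poly ((T * Dpoly N \<delta> s * padj T) $$ (i, i)) (complex_of_real y) = complex_of_real r"
        unfolding Fii[OF ik(1)] 
        by (rule exI, rule conjI[OF _ refl], rule sum_nonneg) (use nn y in auto)
    qed
    hence "complex_of_real (\<Sum>k\<in>{0..<N}. \<delta> s (Suc k) * x ^ Suc k * (cmod (poly (T $$ (i, k)) (of_real
      x)))\<^sup>2) = 0"
      unfolding Fii[OF ik(1), symmetric] by simp
    hence "(\<Sum>k\<in>{0..<N}. \<delta> s (Suc k) * x ^ Suc k * (cmod (poly (T $$ (i, k)) (of_real x)))\<^sup>2) = 0"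
      by (simp only: of_real_eq_0_iff)
    hence "\<delta> s (Suc k) * x ^ Suc k * (cmod (poly (T $$ (i, k)) (of_real x)))\<^sup>2 = 0"
      by (subst (asm) sum_nonneg_eq_0_iff) (use nn x ik in auto)
    thus "poly (T $$ (i, k)) (of_real x) = poly 0 (of_real x)"
      using \<delta>[of "Suc k"] ik x by simp
  qed
  hence T0: "T = 0\<^sub>m N N" using T by (intro eq_matI) auto
  show ?thesis
  proof (rule matpoly_eqI[of _ N N])
    fix x :: real assume "x > 0"
    have L: "Lmat N \<mu> \<alpha> x * minv (Lmat N \<mu> \<alpha> x) = 1\<^sub>m N" "minv (Lmat N \<mu> \<alpha> x) \<in> carrier_mat N N"
      using minv[OF Lmat_carrier, of N \<mu> \<alpha> x] by (simp_all add: det_Lmat[OF \<mu>])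
    have e: "matpoly_eval (0\<^sub>m N N) x = 0\<^sub>m N N" by (intro eq_matI) (auto simp: matpoly_eval_def)
    have "matpoly_eval R x * Lmat N \<mu> \<alpha> x = 0\<^sub>m N N"
      using arg_cong[OF T0, of "\<lambda>A. matpoly_eval A x"] R
      by (simp add: T_def matpoly_eval_mult[of _ N N _ N] matpoly_eval_Lpoly[OF \<mu>] e)
    hence "matpoly_eval R x * Lmat N \<mu> \<alpha> x * minv (Lmat N \<mu> \<alpha> x) = 0\<^sub>m N N"
      using L by (simp add: left_mult_zero_mat[of _ N N])
    thus "matpoly_eval R x = matpoly_eval (0\<^sub>m N N) x"
      using L R by (simp add: assoc_mult_mat[of _ N N _ N _ N] right_mult_one_mat[of _ N N] e)
  qed (use R in auto)
qed

text \<open>The second argument is a function that is polynomial on the positive reals only, because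
  that is all that is known of \<open>Sop\<close>.\<close>

lemma pairing_Wmat:
  assumes \<mu>: "\<forall>k\<in>{1..N}. \<mu> k \<noteq> 0"
    and PQ: "P \<in> carrier_mat N N" "Q \<in> carrier_mat N N"
    and G: "\<And>x. x > 0 \<Longrightarrow> G x = matpoly_eval Q x"
  shows "pairing N (Wmat N \<mu> \<delta> \<alpha> s) (matpoly_eval P) G = mat_ip s (Mpoly N \<mu> \<delta> \<alpha> s) P Q"
proof (rule eq_matI)
  let ?M = "Mpoly N \<mu> \<delta> \<alpha> s"
  fix i j assume "i < dim_row (mat_ip s ?M P Q)" "j < dim_col (mat_ip s ?M P Q)"
  hence ij: "i < N" "j < N" using PQ by (simp_all add: mat_ip_def)
  have F: "P * ?M * padj Q \<in> carrier_mat N N" using PQ by (simp add: square_mat_simps[where N = N])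
  have *: "(matpoly_eval P x * Wmat N \<mu> \<delta> \<alpha> s x * mat_adjoint (G x)) $$ (i, j) =
      complex_of_real (exp (- x) * x powr s) * poly ((P * ?M * padj Q) $$ (i, j)) (complex_of_real x)"
    if x: "x > 0" for x
  proof -
    have "matpoly_eval P x * Wmat N \<mu> \<delta> \<alpha> s x * mat_adjoint (G x) =
        complex_of_real (exp (- x) * x powr s) \<cdot>\<^sub>m matpoly_eval (P * ?M * padj Q) x"
      using PQ unfolding Wmat_eq[OF \<mu> x] G[OF x] matpoly_eval_padj[symmetric]
      by (simp add: matpoly_eval_mult[of _ N N _ N] mult_carrier_mat[of _ N N _ N]
          mult_smult_distrib[of _ N N _ N] mult_smult_assoc_mat[of _ N N _ N])
    moreover have "matpoly_eval (P * ?M * padj Q) x $$ (i, j)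
      = poly ((P * ?M * padj Q) $$ (i, j)) (complex_of_real x)"
      using ij carrier_matD[OF F] by (simp only: matpoly_eval_def index_map_mat)
    ultimately show ?thesis using ij carrier_matD[OF F] by (simp add: matpoly_eval_def)
  qed
  have "set_lebesgue_integral lborel {0<..} (\<lambda>x. (matpoly_eval P x * Wmat N \<mu> \<delta> \<alpha> s x * mat_adjoint (G
    x)) $$ (i, j))
      = lagint s ((P * ?M * padj Q) $$ (i, j))"
    unfolding lagint_def set_lebesgue_integral_def
    by (intro Bochner_Integration.integral_cong refl) (auto simp: indicator_def *)
  thus "pairing N (Wmat N \<mu> \<delta> \<alpha> s) (matpoly_eval P) G $$ (i, j) = mat_ip s ?M P Q $$ (i, j)"
    using ij PQ by (simp add: pairing_def mat_ip_def)
qed (use PQ in \<open>simp_all add: pairing_def mat_ip_def\<close>)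


section \<open>Ladder relations\<close>

lemma pconst_smult_one:
  "A \<in> carrier_mat N N \<Longrightarrow> pconst (a \<cdot>\<^sub>m 1\<^sub>m N) * A = [:a:] \<cdot>\<^sub>m A"
proof -
  assume A: "A \<in> carrier_mat N N"
  have "pconst (a \<cdot>\<^sub>m 1\<^sub>m N) = [:a:] \<cdot>\<^sub>m 1\<^sub>m N"
    unfolding pconst_def by (intro eq_matI) (auto simp: one_pCons)
  thus ?thesis using A by (simp add: mult_smult_assoc_mat[of _ N N _ N] left_mult_one_mat[of _ N N])
qed

lemma mat_diff_eq_0D:
  fixes A B :: "'a :: ab_group_add mat"
  assumes "A - B = 0\<^sub>m n m" "A \<in> carrier_mat n m" "B \<in> carrier_mat n m"
  shows "A = B"
proof (rule eq_matI)
  fix i j assume "i < dim_row B" "j < dim_col B"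
  thus "A $$ (i, j) = B $$ (i, j)"
    using arg_cong[OF assms(1), of "\<lambda>C. C $$ (i, j)"] assms(2,3) by simp
qed (use assms(2,3) in auto)

lemma matpoly_linear:
  assumes P: "P \<in> carrier_mat n m" and "\<And>k. k \<ge> 2 \<Longrightarrow> matpoly_coeff P k = 0\<^sub>m n m"
  shows "P = pconst (matpoly_coeff P 0) + [:0, 1:] \<cdot>\<^sub>m pconst (matpoly_coeff P 1)"
proof (rule eq_matI)
  fix i j assume "i < dim_row (pconst (matpoly_coeff P 0) + [:0, 1:] \<cdot>\<^sub>m pconst (matpoly_coeff P 1))"
    "j < dim_col (pconst (matpoly_coeff P 0) + [:0, 1:] \<cdot>\<^sub>m pconst (matpoly_coeff P 1))"
  hence ij: "i < n" "j < m" using P by (simp_all add: matpoly_coeff_def pconst_def)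
  have "coeff (P $$ (i, j)) k = 0" if "k \<ge> 2" for k
    using arg_cong[OF assms(2)[OF that], of "\<lambda>A. A $$ (i, j)"] ij P by (simp add: matpoly_coeff_def)
  hence "P $$ (i, j) = [:coeff (P $$ (i, j)) 0, coeff (P $$ (i, j)) 1:]"
    by (intro poly_eqI) (auto simp: coeff_pCons split: nat.splits)
  thus "P $$ (i, j) = (pconst (matpoly_coeff P 0) + [:0, 1:] \<cdot>\<^sub>m pconst (matpoly_coeff P 1)) $$ (i, j)"
    using ij P by (simp add: matpoly_coeff_def pconst_def)
qed (use P in \<open>simp_all add: matpoly_coeff_def pconst_def\<close>)

lemma matpoly_coeff_X_deriv:
  "matpoly_coeff ([:0, 1:] \<cdot>\<^sub>m matpoly_deriv Q) k = of_nat k \<cdot>\<^sub>m matpoly_coeff Q k"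
  unfolding matpoly_coeff_def matpoly_deriv_def
  by (intro eq_matI) (auto simp: coeff_pCons coeff_pderiv split: nat.splits)

context laguerre_step
begin

definition Spoly :: "complex poly mat \<Rightarrow> complex poly mat" where
  "Spoly Q = matpoly_deriv Q * Phi_poly + Q * Psi_poly"

lemma Spoly_carrier [simp]: "Q \<in> carrier_mat N N \<Longrightarrow> Spoly Q \<in> carrier_mat N N"
  by (simp add: Spoly_def square_mat_simps[where N = N])

lemma Sop_eq:
  assumes "x > 0" "Q \<in> carrier_mat N N"
  shows "Sop N \<mu> \<delta> \<alpha> \<nu> Q x = matpoly_eval (Spoly Q) x"
  using assms
  by (simp add: Sop_def Spoly_def mat_adjoint_Phi mat_adjoint_Psi matpoly_eval_add[of _ N N]
    matpoly_eval_mult[of _ N N _ N]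
      square_mat_simps[where N = N])

abbreviation "M \<equiv> Mpoly N \<mu> \<delta> \<alpha> \<nu>"
abbreviation "M' \<equiv> Mpoly N \<mu> \<delta> \<alpha> (\<nu> + 1)"

text \<open>Integration by parts for the entries of \<open>F = P M' Q\<^sup>*\<close>. The product
  rule gives three terms: the one differentiating \<open>P\<close> is \<open>H\<close>, and the
  other two, joined with \<open>(\<nu> + 1 - x) F\<close> from the scalar weight, form
  \<open>K\<close>.\<close>

lemma mat_ip_deriv:
  assumes PQ: "P \<in> carrier_mat N N" "Q \<in> carrier_mat N N"
  shows "mat_ip (\<nu> + 1) M' (matpoly_deriv P) Q = - mat_ip \<nu> M P (Spoly Q)"
proof (rule eq_matI)
  fix i j assume "i < dim_row (- mat_ip \<nu> M P (Spoly Q))" "j < dim_col (- mat_ip \<nu> M P (Spoly Q))"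
  hence ij: "i < N" "j < N" using PQ by (simp_all add: mat_ip_def Spoly_def)
  have s: "\<nu> > - 1" using \<nu> by simp
  let ?X = "[:0, 1:] :: complex poly" and ?p = "[:of_real (\<nu> + 1), - 1:] :: complex poly"
  define F where "F = P * M' * padj Q"
  define H where "H = matpoly_deriv P * M' * padj Q"
  define K where "K = P * M * padj (Spoly Q)"
  have carr: "F \<in> carrier_mat N N" "H \<in> carrier_mat N N" "K \<in> carrier_mat N N"
    using PQ by (simp_all add: F_def H_def K_def square_mat_simps[where N = N])
  \<comment> \<open>In the pairing the adjoint of \<open>Spoly Q\<close> stands to the right of
    \<open>M\<close>, so the Pearson equations are needed in adjoint form.\<close>
  have MPhi: "M * padj Phi_poly = ?X \<cdot>\<^sub>m M'"
    using arg_cong[OF Phi_poly_Mpoly, of padj]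
    by (simp add: padj_mult[of _ N N _ N] padj_Mpoly padj_smult map_poly_pCons)
  have MPsi: "M * padj Psi_poly = ?X \<cdot>\<^sub>m matpoly_deriv M' + ?p \<cdot>\<^sub>m M'"
    using arg_cong[OF Psi_poly_Mpoly, of padj]
    by (simp add: padj_mult[of _ N N _ N] padj_Mpoly padj_smult padj_add[of _ N N] map_poly_pCons
        flip: matpoly_deriv_padj)
  have "M * padj (Spoly Q) = M * padj Phi_poly * padj (matpoly_deriv Q) + M * padj Psi_poly * padj Q"
    using PQ by (simp add: Spoly_def padj_add[of _ N N] padj_mult[of _ N N _ N] square_mat_simps[where N = N]
        mult_add_distrib_mat[of _ N N _ N])
  hence K: "K = P * (?X \<cdot>\<^sub>m (M' * padj (matpoly_deriv Q))) + P * (?X \<cdot>\<^sub>m (matpoly_deriv M' * padj Q)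
    + ?p \<cdot>\<^sub>m (M' * padj Q))"
    using PQ unfolding K_def MPhi MPsi
    by (simp add: square_mat_simps[where N = N] mult_add_distrib_mat[of _ N N _ N]
      add_mult_distrib_mat[of _ N N _ _ N]
        mult_smult_assoc_mat[of _ N N _ N])
  have "?X \<cdot>\<^sub>m matpoly_deriv F + ?p \<cdot>\<^sub>m F = ?X \<cdot>\<^sub>m H + K"
  proof -
    define U where "U = P * (M' * padj (matpoly_deriv Q))"
    define V where "V = P * (matpoly_deriv M' * padj Q)"
    have UV: "U \<in> carrier_mat N N" "V \<in> carrier_mat N N"
      using PQ by (simp_all add: U_def V_def square_mat_simps[where N = N])
    have "K = ?X \<cdot>\<^sub>m U + (?X \<cdot>\<^sub>m V + ?p \<cdot>\<^sub>m F)"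
      unfolding K using PQ
      by (simp add: U_def V_def F_def square_mat_simps[where N
        = N] mult_add_distrib_mat[of _ N N _ N] mult_smult_distrib[of _ N N _ N])
    moreover have "matpoly_deriv F = H + V + U"
      using PQ by (simp add: U_def V_def F_def H_def square_mat_simps[where N
        = N] matpoly_deriv_mult[of _ N N _ N] matpoly_deriv_padj
          add_mult_distrib_mat[of _ N N _ _ N] mult_add_distrib_mat[of _ N N _ N] assoc_add_mat[of _ N N])
    ultimately show ?thesis
      using carr UV by (intro eq_matI) (auto simp: algebra_simps)
  qed
  from arg_cong[OF this, of "\<lambda>A. lagint \<nu> (A $$ (i, j))"]
  have "lagint \<nu> (?X * pderiv (F $$ (i, j)) + ?p * F $$ (i, j)) = lagint \<nu> (?X * H $$ (i, j) + K $$ (i, j))"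
    using ij carr by (simp add: matpoly_deriv_def)
  hence "lagint \<nu> (?X * H $$ (i, j) + K $$ (i, j)) = 0"
    using lagint_by_parts[OF s, of "F $$ (i, j)"] by (simp only:)
  hence "lagint (\<nu> + 1) (H $$ (i, j)) + lagint \<nu> (K $$ (i, j)) = 0"
    by (simp only: lagint_add[OF s] lagint_plus_1)
  thus "mat_ip (\<nu> + 1) M' (matpoly_deriv P) Q $$ (i, j) = (- mat_ip \<nu> M P (Spoly Q)) $$ (i, j)"
    using ij carr unfolding mat_ip_def F_def[symmetric] H_def[symmetric] K_def[symmetric]
    by (simp add: eq_neg_iff_add_eq_0)
qed (use PQ in \<open>simp_all add: mat_ip_def Spoly_def\<close>)

section \<open>Leading coefficients and the matrices \<open>K\<^sub>n\<close>\<close>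

definition Phi_coeff where "Phi_coeff = matpoly_coeff Phi_core"
definition Psi_coeff where "Psi_coeff = matpoly_coeff Psi_core"

abbreviation Lc :: "complex mat" where "Lc \<equiv> Lmat N \<mu> \<alpha> 0"

text \<open>The leading coefficient of \<open>S\<close> applied to a monic polynomial of degree
  \<open>k\<close>; the factor \<open>k\<close> comes from the derivative. Thus
  \<open>K\<^sub>n\<close> is \<open>Kmat (n - 1)\<close>.\<close>

definition Kmat :: "nat \<Rightarrow> complex mat" where
  "Kmat k = Lc * (of_nat k \<cdot>\<^sub>m Phi_coeff 1 + Psi_coeff 1) * minv Lc"

lemma Phi_Psi_coeff_carrier [simp]: "Phi_coeff k \<in> carrier_mat N N" "Psi_coeff k \<in> carrier_mat N N"
  by (simp_all add: Phi_coeff_def Psi_coeff_def)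

lemma Kmat_carrier [simp]: "Kmat k \<in> carrier_mat N N"
  by (simp add: Kmat_def square_mat_simps[where N = N])

lemma Phi_core_linear: "Phi_core = pconst (Phi_coeff 0) + [:0, 1:] \<cdot>\<^sub>m pconst (Phi_coeff 1)"
  and Psi_core_linear: "Psi_core = pconst (Psi_coeff 0) + [:0, 1:] \<cdot>\<^sub>m pconst (Psi_coeff 1)"
proof -
  have "matpoly_coeff Phi_core k = 0\<^sub>m N N" "matpoly_coeff Psi_core k = 0\<^sub>m N N" if "k \<ge> 2" for k
    using that by (auto intro!: eq_matI simp: matpoly_coeff_def Phi_core_def Psi_core_def scaled_mat_def
      tri_def coeff_pCons split: nat.splits)
  thus "Phi_core = pconst (Phi_coeff 0) + [:0, 1:] \<cdot>\<^sub>m pconst (Phi_coeff 1)" "Psi_core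
    = pconst (Psi_coeff 0) + [:0, 1:] \<cdot>\<^sub>m pconst (Psi_coeff 1)"
    unfolding Phi_coeff_def Psi_coeff_def by (blast intro: matpoly_linear core_carrier)+
qed

text \<open>\<open>Phi_poly\<close> has only terms in \<open>x\<close> and \<open>x^2\<close>,
  \<open>Psi_poly\<close> only terms in \<open>1\<close> and \<open>x\<close>, so two neighbouring
  coefficients of \<open>Q\<close> contribute.\<close>

lemma matpoly_coeff_Spoly:
  assumes Q: "Q \<in> carrier_mat N N"
  shows "matpoly_coeff (Spoly Q) (Suc k) =
     matpoly_coeff Q (Suc k) * (of_nat (Suc k) \<cdot>\<^sub>m (Lc * Phi_coeff 0 * minv Lc) + Lc * Psi_coeff 0 * minv Lc)
     + matpoly_coeff Q k * Kmat k"
proof -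
  let ?X = "[:0, 1:] :: complex poly"
  define a0 where "a0 = Lc * Phi_coeff 0 * minv Lc"
  define a1 where "a1 = Lc * Phi_coeff 1 * minv Lc"
  define b0 where "b0 = Lc * Psi_coeff 0 * minv Lc"
  define b1 where "b1 = Lc * Psi_coeff 1 * minv Lc"
  have c: "a0 \<in> carrier_mat N N" "a1 \<in> carrier_mat N N" "b0 \<in> carrier_mat N N" "b1 \<in> carrier_mat N N"
    by (simp_all add: a0_def a1_def b0_def b1_def square_mat_simps[where N = N])
  have p: "L0 * pconst U * L0i = pconst (Lc * U * minv Lc)" if "U \<in> carrier_mat N N" for U
    using that by (simp add: pconst_mult[of _ N N _ N] square_mat_simps[where N = N])
  have Phi: "Phi_poly = ?X \<cdot>\<^sub>m (pconst a0 + ?X \<cdot>\<^sub>m pconst a1)"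
    unfolding Phi_poly_def a0_def a1_def p[OF Phi_Psi_coeff_carrier(1), symmetric] by (subst Phi_core_linear)
       (simp add: sq_simps mult_add_distrib_mat[of _ N N _ N] add_mult_distrib_mat[of _ N N _ _ N])
  have Psi: "Psi_poly = pconst b0 + ?X \<cdot>\<^sub>m pconst b1"
    unfolding Psi_poly_def b0_def b1_def p[OF Phi_Psi_coeff_carrier(2), symmetric] by (subst Psi_core_linear)
       (simp add: sq_simps mult_add_distrib_mat[of _ N N _ N] add_mult_distrib_mat[of _ N N _ _ N])
  have Spoly: "Spoly Q = (?X \<cdot>\<^sub>m matpoly_deriv Q) * pconst a0 + ?X \<cdot>\<^sub>m ((?X \<cdot>\<^sub>m matpoly_deriv Q) * pconst a1)
      + Q * pconst b0 + ?X \<cdot>\<^sub>m (Q * pconst b1)"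
  proof -
    define U V W Y where "U = matpoly_deriv Q * pconst a0" and "V = matpoly_deriv Q * pconst a1"
      and "W = Q * pconst b0" and "Y = Q * pconst b1"
    note defs = U_def V_def W_def Y_def
    have carr: "U \<in> carrier_mat N N" "V \<in> carrier_mat N N" "W \<in> carrier_mat N N" "Y \<in> carrier_mat N N"
      using Q c by (simp_all add: defs square_mat_simps[where N = N])
    have "Spoly Q = ?X \<cdot>\<^sub>m (U + ?X \<cdot>\<^sub>m V) + (W + ?X \<cdot>\<^sub>m Y)"
      unfolding Spoly_def Phi Psi defs using Q c by (simp add: sq_simps mult_add_distrib_mat[of _ N N _ N])
    also have "\<dots> = ?X \<cdot>\<^sub>m U + ?X \<cdot>\<^sub>m (?X \<cdot>\<^sub>m V) + W + ?X \<cdot>\<^sub>m Y"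
      using carr by (intro eq_matI) (auto simp: algebra_simps)
    finally show ?thesis
      using Q c by (simp add: defs mult_smult_assoc_mat[of _ N N _ N])
  qed
  have "matpoly_coeff (Spoly Q) (Suc k) = of_nat (Suc k) \<cdot>\<^sub>m matpoly_coeff Q (Suc k) * a0
      + of_nat k \<cdot>\<^sub>m matpoly_coeff Q k * a1 + matpoly_coeff Q (Suc k) * b0 + matpoly_coeff Q k * b1"
    unfolding Spoly using Q c
    by (simp add: matpoly_coeff_add[of _ N N] matpoly_coeff_mult_pconst[of _ N N _ N] matpoly_coeff_smult_X
        matpoly_coeff_X_deriv matpoly_coeff_deriv square_mat_simps[where N = N] del: of_nat_Suc)
  moreover have "Kmat k = of_nat k \<cdot>\<^sub>m a1 + b1"
    unfolding Kmat_def a1_def b1_def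
    by (simp add: sq_simps mult_add_distrib_mat[of _ N N _ N] add_mult_distrib_mat[of _ N N _ _ N])
  ultimately show ?thesis
    unfolding a0_def[symmetric] b0_def[symmetric] using c Q
    by (intro eq_matI) (auto simp: mult_add_distrib_mat[of _ N N _ N] mult_smult_distrib[of _ N N _ N]
         mult_smult_assoc_mat[of _ N N _ N])
qed

lemma deg_less_Spoly:
  assumes "deg_less N n Q" shows "deg_less N (Suc n) (Spoly Q)"
  unfolding deg_less_def
proof (intro conjI allI impI)
  show "Spoly Q \<in> carrier_mat N N" using assms by (simp add: deg_less_def)
  fix k assume "Suc n \<le> k"
  then obtain k' where "k = Suc k'" "n \<le> k'" by (cases k) auto
  thus "matpoly_coeff (Spoly Q) k = 0\<^sub>m N N"
    using assms by (simp add: deg_less_def matpoly_coeff_Spoly left_mult_zero_mat[of _ N N]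
      square_mat_simps[where N = N] del: of_nat_Suc)
qed

lemma deg_less_deriv:
  assumes "deg_less N (Suc n) Q" shows "deg_less N n (matpoly_deriv Q)"
  using assms by (auto simp: deg_less_def matpoly_coeff_deriv simp del: of_nat_Suc)

text \<open>Kept literally in the shape of the explicit formula to be proved, with \<open>n\<close>
  the degree after raising.\<close>

definition Kcore :: "nat \<Rightarrow> complex mat" where
  "Kcore n = complex_of_real d \<cdot>\<^sub>m
                  (Jmat N
                   - (Jmat N + complex_of_real (\<nu> + real n) \<cdot>\<^sub>m 1\<^sub>m N) * Amat N \<mu>
                   - of_nat N \<cdot>\<^sub>m 1\<^sub>m N - 1\<^sub>m N)
                - complex_of_real c \<cdot>\<^sub>m 1\<^sub>m N"

text \<open>The linear coefficient of \<open>Phi_core\<close> is \<open>- d A\<close>; taken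
  \<open>k\<close> times it turns \<open>J + \<nu> + 1\<close> into
  \<open>J + \<nu> + k + 1\<close>, which accounts for the index \<open>Suc k\<close>.\<close>

lemma Kcore_eq: "of_nat k \<cdot>\<^sub>m Phi_coeff 1 + Psi_coeff 1 = Kcore (Suc k)"
proof (rule eq_matI)
  have J: "Jmat N + complex_of_real (\<nu> + real (Suc k)) \<cdot>\<^sub>m 1\<^sub>m N =
      mat_diag N (\<lambda>i. complex_of_real (\<nu> + real (Suc k) + real (Suc i)))"
    unfolding mat_diag_def by (intro eq_matI) (auto simp: Jmat_def)
  have A: "Amat N \<mu> \<in> carrier_mat N N" by (simp add: Amat_def)
  fix i j assume "i < dim_row (Kcore (Suc k))" "j < dim_col (Kcore (Suc k))"
  hence ij: "i < N" "j < N" by (simp_all add: Kcore_def Amat_def)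
  show "(of_nat k \<cdot>\<^sub>m Phi_coeff 1 + Psi_coeff 1) $$ (i, j) = Kcore (Suc k) $$ (i, j)"
  proof -
    have "\<mu> (Suc j) \<noteq> 0" using ij \<mu> by simp
    thus ?thesis
      unfolding Kcore_def J mat_diag_mult_left[OF A] using ij
      by (auto simp: Phi_coeff_def Psi_coeff_def Phi_core_def Psi_core_def scaled_mat_def tri_def
        matpoly_coeff_def Jmat_def Amat_def coeff_pCons)
         (simp_all add: field_simps)
  qed
qed (simp_all add: Phi_coeff_def Psi_coeff_def Phi_core_def Psi_core_def scaled_mat_def
  matpoly_coeff_def Kcore_def Amat_def)

lemma minv_Kmat: "minv Lc * Kmat k * Lc = Kcore (Suc k)"
proof -
  have K: "Kcore (Suc k) \<in> carrier_mat N N" unfolding Kcore_eq[symmetric] by simp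
  have "minv Lc * Kmat k * Lc = (minv Lc * Lc) * Kcore (Suc k) * (minv Lc * Lc)"
    unfolding Kmat_def Kcore_eq using K by (simp add: sq_simps)
  thus ?thesis using K minv_Lmat by (simp add: left_mult_one_mat[of _ N N] right_mult_one_mat[of _ N N])
qed

text \<open>\<open>Kcore\<close> is lower triangular, and its diagonal entry in row \<open>i\<close>
  is minus the ratio of \<open>\<delta> (\<nu> + 1)\<close> to \<open>\<delta> \<nu>\<close> at
  index \<open>N - i\<close>, nonzero by positivity.\<close>

lemma det_Kmat: "det (Kmat k) \<noteq> 0"
proof -
  have K: "Kcore (Suc k) \<in> carrier_mat N N" unfolding Kcore_eq[symmetric] by simp
  have e: "Kcore (Suc k) $$ (i, j) = (if i = j then - of_real (d * real (N - i) + c) else 0)" if "i \<le> j"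
    "j < N" for i j
  proof -
    have "\<mu> (Suc j) \<noteq> 0" using that \<mu> by simp
    thus ?thesis
      unfolding Kcore_eq[symmetric] using that
      by (auto simp: Phi_coeff_def Psi_coeff_def Phi_core_def Psi_core_def scaled_mat_def tri_def
        matpoly_coeff_def of_nat_diff)
         (simp_all add: algebra_simps)
  qed
  have "d * real (N - i) + c \<noteq> 0" if "i < N" for i
  proof -
    have "N - i \<in> {1..N}" using that by auto
    from \<delta>_pos(2)[OF this] \<delta>_Suc[OF this] show ?thesis by auto
  qed
  hence "prod_list (diag_mat (Kcore (Suc k))) \<noteq> 0"
    using K by (auto simp: prod_list_zero_iff diag_mat_def e simp flip: of_real_add of_real_mult)
  moreover have "det (Kcore (Suc k)) = prod_list (diag_mat (Kcore (Suc k)))"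
    by (rule det_lower_triangular[OF _ K]) (simp add: e)
  moreover have "det (minv Lc) * det (Kmat k) * det Lc = det (Kcore (Suc k))"
    unfolding minv_Kmat[symmetric] by (simp add: det_mult[of _ N] square_mat_simps[where N = N])
  ultimately show ?thesis by auto
qed

lemma invertible_Kmat: "invertible_mat (Kmat k)"
  using minv[OF Kmat_carrier det_Kmat, of k] carrier_matD[OF Kmat_carrier, of k]
  by (auto simp: invertible_mat_def inverts_mat_def square_mat.simps intro!: exI[of _ "minv (Kmat k)"])

context
  fixes P P' :: "nat \<Rightarrow> complex poly mat"
  assumes P: "\<And>n. monic_of_degree N n (P n)" "\<And>n m. n \<noteq> m \<Longrightarrow> mat_ip \<nu> M (P n) (P m) = 0\<^sub>m N N"
    and P': "\<And>n. monic_of_degree N n (P' n)" "\<And>n m. n \<noteq> m \<Longrightarrow> mat_ip (\<nu> + 1) M' (P' n) (P' m) = 0\<^sub>m N N"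
begin

lemma P_carrier: "P n \<in> carrier_mat N N" "P' n \<in> carrier_mat N N"
  using P(1) P'(1) by (simp_all add: monic_of_degree_def)

text \<open>The leading terms agree, so the difference \<open>R\<close> has degree below
  \<open>n\<close>. Its pairing with itself vanishes: \<open>P' n\<close> is orthogonal to
  \<open>R\<close>, and adjointness turns the derivative into \<open>Spoly R\<close>, of degree
  below \<open>Suc n\<close>.\<close>

lemma ladder_down: "matpoly_deriv (P (Suc n)) = [:of_nat (Suc n):] \<cdot>\<^sub>m P' n"
proof -
  \<comment> \<open>The scalar is written as a constant matrix, so that the rule for left factors of
    \<open>mat_ip\<close> applies.\<close>
  define C where "C = complex_of_nat (Suc n) \<cdot>\<^sub>m 1\<^sub>m N"
  define R where "R = matpoly_deriv (P (Suc n)) - pconst C * P' n"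
  have CP: "pconst C * P' n = [:of_nat (Suc n):] \<cdot>\<^sub>m P' n"
    unfolding C_def by (rule pconst_smult_one[OF P_carrier(2)])
  have C: "C \<in> carrier_mat N N" by (simp add: C_def)
  have s: "\<nu> > - 1" "\<nu> + 1 > - 1" using \<nu> by simp_all
  have c: "matpoly_deriv (P (Suc n)) \<in> carrier_mat N N" "pconst C * P' n \<in> carrier_mat N N"
    "R \<in> carrier_mat N N"
    using C P_carrier by (simp_all add: R_def CP minus_carrier_mat)
  have dl: "deg_less N n R"
    unfolding deg_less_def
  proof (intro conjI allI impI)
    fix k assume "n \<le> k"
    then consider "k = n" | "k > n" by linarith
    thus "matpoly_coeff R k = 0\<^sub>m N N"
      using P(1)[of "Suc n"] P'(1)[of n]
      by cases (auto simp: R_def matpoly_coeff_diff[OF c(1,2)], auto simp: CP matpoly_coeff_deriv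
        matpoly_coeff_smult_const
           monic_of_degree_def intro!: eq_matI simp del: of_nat_Suc)
  qed (use c in simp)
  have "mat_ip (\<nu> + 1) M' R R = mat_ip (\<nu> + 1) M' (matpoly_deriv (P (Suc n))) R - C * mat_ip (\<nu>
    + 1) M' (P' n) R"
    by (subst (1) R_def) (simp add: mat_ip_diff_left[OF s(2) Mpoly_carrier(3) c] mat_ip_pconst_left[OF
      s(2) Mpoly_carrier(3) P_carrier(2) C c(3)])
  also have "mat_ip (\<nu> + 1) M' (P' n) R = 0\<^sub>m N N"
    using orthogonal_deg_less[OF s(2) Mpoly_carrier(3) P' dl] by simp
  also have "mat_ip (\<nu> + 1) M' (matpoly_deriv (P (Suc n))) R = - mat_ip \<nu> M (P (Suc n)) (Spoly R)"
    by (rule mat_ip_deriv[OF P_carrier(1) c(3)])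
  also have "mat_ip \<nu> M (P (Suc n)) (Spoly R) = 0\<^sub>m N N"
    using orthogonal_deg_less[OF s(1) Mpoly_carrier(3) P deg_less_Spoly[OF dl]] by simp
  also have "- 0\<^sub>m N N - C * 0\<^sub>m N N = 0\<^sub>m N N"
    using C by (intro eq_matI) auto
  finally have R0: "mat_ip (\<nu> + 1) M' R R = 0\<^sub>m N N" .
  have "R = 0\<^sub>m N N"
    by (rule mat_ip_pos_def[where \<delta> = \<delta> and s = "\<nu> + 1", OF \<mu> s(2) _ c(3) R0]) (rule \<delta>_pos(2))
  thus ?thesis
    using mat_diff_eq_0D[OF _ c(1,2)] unfolding R_def CP by simp
qed

text \<open>\<open>Kmat n\<close> is the leading coefficient of the left-hand side, so
  \<open>R\<close> has degree below \<open>Suc n\<close>. Adjointness is now used backwards and puts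
  the derivative on \<open>R\<close>, of degree below \<open>n\<close>.\<close>

lemma ladder_up: "Spoly (P' n) = pconst (Kmat n) * P (Suc n)"
proof -
  define R where "R = Spoly (P' n) - pconst (Kmat n) * P (Suc n)"
  have s: "\<nu> > - 1" "\<nu> + 1 > - 1" using \<nu> by simp_all
  have c: "Spoly (P' n) \<in> carrier_mat N N" "pconst (Kmat n) * P (Suc n) \<in> carrier_mat N N" "R \<in> carrier_mat N N"
    using P_carrier by (simp_all add: R_def minus_carrier_mat square_mat_simps[where N = N])
  have dl: "deg_less N (Suc n) R"
    unfolding deg_less_def
  proof (intro conjI allI impI)
    fix k assume "Suc n \<le> k"
    then obtain k' where k: "k = Suc k'" "n \<le> k'" by (cases k) auto
    then consider "k' = n" | "k' > n" by linarith
    thus "matpoly_coeff R k = 0\<^sub>m N N"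
      using P(1)[of "Suc n"] P'(1)[of n] k
      by cases (simp_all add: R_def matpoly_coeff_diff[OF c(1,2)] matpoly_coeff_Spoly P_carrier
          matpoly_coeff_pconst_mult[OF Kmat_carrier P_carrier(1)] monic_of_degree_def
          left_mult_zero_mat[of _ N N] right_mult_zero_mat[of _ N N] left_mult_one_mat[of _ N N]
          right_mult_one_mat[of _ N N] square_mat_simps[where N = N] minus_r_inv_mat[of _ N N] del: of_nat_Suc)
  qed (use c in simp)
  have "mat_ip \<nu> M R R = mat_ip \<nu> M R (Spoly (P' n)) - mat_ip \<nu> M R (P (Suc n)) * mat_adjoint (Kmat n)"
    by (subst (2) R_def) (simp add: mat_ip_diff_right[OF s(1) Mpoly_carrier(3) c(3,2,1)]
        mat_ip_pconst_right[OF s(1) Mpoly_carrier(3) c(3) Kmat_carrier P_carrier(1)])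
  also have "mat_ip \<nu> M R (P (Suc n)) = 0\<^sub>m N N"
    using orthogonal_deg_less[OF s(1) Mpoly_carrier(3) P dl] by simp
  also have "mat_ip \<nu> M R (Spoly (P' n)) = - mat_ip (\<nu> + 1) M' (matpoly_deriv R) (P' n)"
    unfolding mat_ip_deriv[OF c(3) P_carrier(2)] by simp
  also have "mat_ip (\<nu> + 1) M' (matpoly_deriv R) (P' n) = 0\<^sub>m N N"
    using orthogonal_deg_less[OF s(2) Mpoly_carrier(3) P' deg_less_deriv[OF dl]] by simp
  also have "- 0\<^sub>m N N - 0\<^sub>m N N * mat_adjoint (Kmat n) = 0\<^sub>m N N"
    by (simp add: left_mult_zero_mat[of _ N N]) (intro eq_matI, auto)
  finally have R0: "mat_ip \<nu> M R R = 0\<^sub>m N N" .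
  have "R = 0\<^sub>m N N"
    by (rule mat_ip_pos_def[where \<delta> = \<delta> and s = \<nu>, OF \<mu> s(1) _ c(3) R0]) (rule \<delta>_pos(1))
  thus ?thesis
    using mat_diff_eq_0D[OF _ c(1,2)] unfolding R_def by simp
qed

end

end

theorem proposition6p1:
  fixes N :: nat and \<mu> :: "nat \<Rightarrow> real" and \<alpha> \<nu>\<^sub>0 :: real
    and \<delta> :: "real \<Rightarrow> nat \<Rightarrow> real" and c d :: "real \<Rightarrow> real" and V :: "real set"
  defines "V \<equiv> {\<nu>\<^sub>0 + real k | k :: nat. True}"
  assumes "N \<ge> 1"
    and "\<And>k. k \<in> {1..N} \<Longrightarrow> \<mu> k \<noteq> 0"
    and "\<alpha> > 0" and "\<nu>\<^sub>0 > 0"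
    and "\<And>\<nu> k. \<nu> \<in> V \<Longrightarrow> k \<in> {1..N} \<Longrightarrow> \<delta> \<nu> k > 0"
    and "\<And>\<nu> k. \<nu> \<in> V \<Longrightarrow> k \<in> {1..N} \<Longrightarrow> \<delta> (\<nu> + 1) k = (d \<nu> * real k + c \<nu>) * \<delta> \<nu> k"
    and "\<And>\<nu> k. \<nu> \<in> V \<Longrightarrow> 1 \<le> k \<Longrightarrow> k < N \<Longrightarrow>
           (\<mu> (k + 1))\<^sup>2 / (\<mu> k)\<^sup>2 = d \<nu> * real k * (real N - real k) * (\<delta> \<nu> (k + 1) / \<delta> (\<nu> + 1) k)"
  shows
    "(\<forall>\<nu>\<in>V. \<forall>P\<in>carrier_mat N N. \<forall>Q\<in>carrier_mat N N.
        pairing N (Wmat N \<mu> \<delta> \<alpha> (\<nu> + 1)) (matpoly_eval (matpoly_deriv P)) (matpoly_eval Q)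
        = - pairing N (Wmat N \<mu> \<delta> \<alpha> \<nu>) (matpoly_eval P) (Sop N \<mu> \<delta> \<alpha> \<nu> Q))
   \<and> (\<forall>P. (\<forall>\<nu>\<in>V. monic_orthogonal N (Wmat N \<mu> \<delta> \<alpha> \<nu>) (P \<nu>)) \<longrightarrow>
        (\<forall>\<nu>\<in>V. \<forall>n\<ge>1.
           matpoly_deriv (P \<nu> n) = of_nat n \<cdot>\<^sub>m P (\<nu> + 1) (n - 1)
         \<and> (\<exists>K\<in>carrier_mat N N.
              (\<forall>x>0. Sop N \<mu> \<delta> \<alpha> \<nu> (P (\<nu> + 1) (n - 1)) x = K * matpoly_eval (P \<nu> n) x)
            \<and> invertible_mat K
            \<and> minv (Lmat N \<mu> \<alpha> 0) * K * Lmat N \<mu> \<alpha> 0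
              = complex_of_real (d \<nu>) \<cdot>\<^sub>m
                  (Jmat N
                   - (Jmat N + complex_of_real (\<nu> + real n) \<cdot>\<^sub>m 1\<^sub>m N) * Amat N \<mu>
                   - of_nat N \<cdot>\<^sub>m 1\<^sub>m N - 1\<^sub>m N)
                - complex_of_real (c \<nu>) \<cdot>\<^sub>m 1\<^sub>m N)))"
proof -
  have V_pos: "\<nu> > 0" if "\<nu> \<in> V" for \<nu>
    using that \<open>\<nu>\<^sub>0 > 0\<close> by (auto simp: V_def)
  \<comment> \<open>Closure under the shift supplies positivity of \<open>\<delta>\<close> and the
    orthogonal family at \<open>\<nu> + 1\<close>.\<close>
  have V_Suc: "\<nu> + 1 \<in> V" if "\<nu> \<in> V" for \<nu>
  proof -
    from that obtain k :: nat where "\<nu> = \<nu>\<^sub>0 + real k" by (auto simp: V_def)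
    hence "\<nu> + 1 = \<nu>\<^sub>0 + real (Suc k)" by simp
    thus ?thesis unfolding V_def by blast
  qed
  have step: "laguerre_step N \<mu> \<delta> \<nu> (c \<nu>) (d \<nu>)" if "\<nu> \<in> V" for \<nu>
  proof unfold_locales
    show "\<forall>k\<in>{1..N}. \<mu> k \<noteq> 0" using assms(3) by blast
  qed (fact V_pos[OF that] assms(6)[OF that] assms(6)[OF V_Suc[OF that]] assms(7)[OF that] assms(8)[OF that])+
  show ?thesis
  proof (intro conjI ballI allI impI)
    fix \<nu> and P Q :: "complex poly mat"
    assume nuV: "\<nu> \<in> V" and PQ: "P \<in> carrier_mat N N" "Q \<in> carrier_mat N N"
    interpret laguerre_step N \<mu> \<delta> \<alpha> \<nu> "c \<nu>" "d \<nu>" by (rule step[OF nuV])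
    show "pairing N (Wmat N \<mu> \<delta> \<alpha> (\<nu> + 1)) (matpoly_eval (matpoly_deriv P)) (matpoly_eval Q)
        = - pairing N (Wmat N \<mu> \<delta> \<alpha> \<nu>) (matpoly_eval P) (Sop N \<mu> \<delta> \<alpha> \<nu> Q)"
      using PQ mat_ip_deriv[OF PQ] by (simp add: pairing_Wmat[OF \<mu>, of _ Q] pairing_Wmat[OF \<mu>, of _
        "Spoly Q"] Sop_eq)
  next
    fix P :: "real \<Rightarrow> nat \<Rightarrow> complex poly mat" and \<nu> and n :: nat
    assume orth: "\<forall>\<nu>\<in>V. monic_orthogonal N (Wmat N \<mu> \<delta> \<alpha> \<nu>) (P \<nu>)"
      and nuV: "\<nu> \<in> V" and n: "n \<ge> 1"
    interpret laguerre_step N \<mu> \<delta> \<alpha> \<nu> "c \<nu>" "d \<nu>" by (rule step[OF nuV])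
    have mono: "monic_of_degree N m (P s m)" if "s \<in> V" for s m
      using orth that by (auto simp: monic_orthogonal_def)
    have mat_ip: "mat_ip s (Mpoly N \<mu> \<delta> \<alpha> s) (P s m) (P s k) = 0\<^sub>m N N" if "s \<in> V" "m \<noteq> k" for s m k
      using orth that mono[OF that(1)]
      by (subst pairing_Wmat[OF \<mu>, symmetric]) (auto simp: monic_orthogonal_def monic_of_degree_def)
    note lad = mono[OF nuV] mat_ip[OF nuV] mono[OF V_Suc[OF nuV]] mat_ip[OF V_Suc[OF nuV]]
    have carr: "P (\<nu> + 1) k \<in> carrier_mat N N" "P \<nu> k \<in> carrier_mat N N" for k
      using mono[OF nuV] mono[OF V_Suc[OF nuV]] by (auto simp: monic_of_degree_def)
    \<comment> \<open>Since \<open>n \<ge> 1\<close>, the ladder lemmas apply at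
      \<open>n - 1\<close>; \<open>of_nat n\<close> is the constant polynomial that they
      produce.\<close>
    show "matpoly_deriv (P \<nu> n) = of_nat n \<cdot>\<^sub>m P (\<nu> + 1) (n - 1)"
      using ladder_down[of "P \<nu>" "P (\<nu> + 1)" "n - 1", OF lad] n by (simp add: of_nat_poly)
    have "Sop N \<mu> \<delta> \<alpha> \<nu> (P (\<nu> + 1) (n - 1)) x = Kmat (n - 1) * matpoly_eval (P \<nu> n) x" if "x > 0" for x
      using ladder_up[of "P \<nu>" "P (\<nu> + 1)" "n - 1", OF lad] n carr
      by (simp add: Sop_eq[OF that] matpoly_eval_mult[of _ N N _ N])
    moreover have "minv Lc * Kmat (n - 1) * Lc = Kcore n"
      using minv_Kmat[of "n - 1"] n by simp
    ultimately show "\<exists>K\<in>carrier_mat N N.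
              (\<forall>x>0. Sop N \<mu> \<delta> \<alpha> \<nu> (P (\<nu> + 1) (n - 1)) x = K * matpoly_eval (P \<nu> n) x)
            \<and> invertible_mat K
            \<and> minv (Lmat N \<mu> \<alpha> 0) * K * Lmat N \<mu> \<alpha> 0
              = complex_of_real (d \<nu>) \<cdot>\<^sub>m
                  (Jmat N
                   - (Jmat N + complex_of_real (\<nu> + real n) \<cdot>\<^sub>m 1\<^sub>m N) * Amat N \<mu>
                   - of_nat N \<cdot>\<^sub>m 1\<^sub>m N - 1\<^sub>m N)
                - complex_of_real (c \<nu>) \<cdot>\<^sub>m 1\<^sub>m N"
      unfolding Kcore_def using Kmat_carrier invertible_Kmat by blast
  qed
qed

end
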